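(* Perfectly well-ve-dominated graphs can be recognized in linear time; that is, given a graph $G$, it can be decided in linear time whether $G$ is perfectly well-ve-dominated.
   Context: All graphs are finite, simple and undirected. A vertex $v$ ve-dominates an edge $e$ if at least one endpoint of $e$ belongs to the closed neighborhood $N_G[v]$. A set $D\subseteq V(G)$ is a ve-dominating set if every edge of $G$ is ve-dominated by some vertex of $D$; it is minimal if no proper subset is ve-dominating. $G$ is well-ve-dominated if all its minimal ve-dominating sets have the same cardinality, and perfectly well-ve-dominated if every induced subgraph of $G$ is well-ve-dominated. Linear time means time $O(|V(G)|+|E(G)|)$. *)

theory Defs
  imports Main
begin

section \<open>Vertex-edge domination\<close>

text \<open>A graph is given by its vertex set \<open>V\<close> and its set \<open>E\<close> of two-element edges.\<close>

definition simple_graph :: "'a set \<Rightarrow> 'a set set \<Rightarrow> bool" where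
  "simple_graph V E \<longleftrightarrow> finite V \<and> (\<forall>e\<in>E. e \<subseteq> V \<and> card e = 2)"

definition closed_neighborhood :: "'a set set \<Rightarrow> 'a \<Rightarrow> 'a set" where
  "closed_neighborhood E v = insert v {u. {v, u} \<in> E}"

definition induced_edges :: "'a set set \<Rightarrow> 'a set \<Rightarrow> 'a set set" where
  "induced_edges E S = {e \<in> E. e \<subseteq> S}"

definition ve_dominates :: "'a set set \<Rightarrow> 'a \<Rightarrow> 'a set \<Rightarrow> bool" where
  "ve_dominates E v e \<longleftrightarrow> (\<exists>x\<in>e. x \<in> closed_neighborhood E v)"

definition ve_dominating_set :: "'a set \<Rightarrow> 'a set set \<Rightarrow> 'a set \<Rightarrow> bool" where
  "ve_dominating_set V E D \<longleftrightarrow> D \<subseteq> V \<and> (\<forall>e\<in>E. \<exists>v\<in>D. ve_dominates E v e)"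

definition minimal_ve_dominating_set :: "'a set \<Rightarrow> 'a set set \<Rightarrow> 'a set \<Rightarrow> bool" where
  "minimal_ve_dominating_set V E D \<longleftrightarrow>
     ve_dominating_set V E D \<and> (\<forall>D'. D' \<subset> D \<longrightarrow> \<not> ve_dominating_set V E D')"

definition well_ve_dominated :: "'a set \<Rightarrow> 'a set set \<Rightarrow> bool" where
  "well_ve_dominated V E \<longleftrightarrow>
     (\<forall>D D'. minimal_ve_dominating_set V E D \<longrightarrow> minimal_ve_dominating_set V E D' \<longrightarrow>
        card D = card D')"

definition perfectly_well_ve_dominated :: "'a set \<Rightarrow> 'a set set \<Rightarrow> bool" where
  "perfectly_well_ve_dominated V E \<longleftrightarrow>
     (\<forall>S. S \<subseteq> V \<longrightarrow> well_ve_dominated S (induced_edges E S))"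

section \<open>Random access machines\<close>

text \<open>
  A word RAM with unit-cost instructions: registers and a memory, both indexed by natural
  numbers, with indirect addressing of the memory. \<open>Sub\<close> is truncated subtraction. In all
  instructions the destination comes first, except that \<open>Store a b\<close> writes register \<open>b\<close> to
  the memory cell whose address is in register \<open>a\<close>. The machine halts when the program
  counter leaves the program.
\<close>

datatype instr =
    Const nat nat
  | Copy nat nat
  | Add nat nat nat
  | Sub nat nat nat
  | Load nat nat
  | Store nat nat
  | Jump nat
  | JumpZero nat nat

record config =
  pc :: nat
  regs :: "nat \<Rightarrow> nat"
  mem :: "nat \<Rightarrow> nat"

definition set_reg :: "nat \<Rightarrow> nat \<Rightarrow> config \<Rightarrow> config" where
  "set_reg a x s = s\<lparr>pc := Suc (pc s), regs := (regs s)(a := x)\<rparr>"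

fun exec_instr :: "instr \<Rightarrow> config \<Rightarrow> config" where
  "exec_instr (Const a x) s = set_reg a x s"
| "exec_instr (Copy a b) s = set_reg a (regs s b) s"
| "exec_instr (Add a b c) s = set_reg a (regs s b + regs s c) s"
| "exec_instr (Sub a b c) s = set_reg a (regs s b - regs s c) s"
| "exec_instr (Load a b) s = set_reg a (mem s (regs s b)) s"
| "exec_instr (Store a b) s = s\<lparr>pc := Suc (pc s), mem := (mem s)(regs s a := regs s b)\<rparr>"
| "exec_instr (Jump l) s = s\<lparr>pc := l\<rparr>"
| "exec_instr (JumpZero a l) s = s\<lparr>pc := (if regs s a = 0 then l else Suc (pc s))\<rparr>"

definition halted :: "instr list \<Rightarrow> config \<Rightarrow> bool" where
  "halted P s \<longleftrightarrow> length P \<le> pc s"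

definition step :: "instr list \<Rightarrow> config \<Rightarrow> config" where
  "step P s = (if halted P s then s else exec_instr (P ! pc s) s)"

definition run :: "instr list \<Rightarrow> nat \<Rightarrow> config \<Rightarrow> config" where
  "run P t s = (step P ^^ t) s"

definition initial_config :: "nat list \<Rightarrow> config" where
  "initial_config xs =
     \<lparr>pc = 0, regs = (\<lambda>_. 0), mem = (\<lambda>i. if i < length xs then xs ! i else 0)\<rparr>"

definition accepting :: "config \<Rightarrow> bool" where
  "accepting s \<longleftrightarrow> regs s 0 \<noteq> 0"

definition values_below :: "nat \<Rightarrow> config \<Rightarrow> bool" where
  "values_below W s \<longleftrightarrow> (\<forall>i. regs s i < W \<and> mem s i < W)"

section \<open>Linear-time recognition of graph classes\<close>

text \<open>
  The input graph has vertices \<open>0, \<dots>, n - 1\<close> and is given by its adjacency lists, each in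
  an arbitrary order.
\<close>

definition adjacency_lists :: "nat \<Rightarrow> nat set set \<Rightarrow> nat list list \<Rightarrow> bool" where
  "adjacency_lists n E adj \<longleftrightarrow>
     length adj = n \<and> (\<forall>v<n. distinct (adj ! v) \<and> set (adj ! v) = {u. {v, u} \<in> E})"

text \<open>
  Memory layout: cell \<open>0\<close> holds \<open>n\<close>; the list of vertex \<open>v\<close> occupies the cells from the
  address in cell \<open>v + 1\<close> up to, but excluding, the address in cell \<open>v + 2\<close>.
\<close>

definition list_start :: "nat list list \<Rightarrow> nat \<Rightarrow> nat" where
  "list_start adj v = length adj + 2 + length (concat (take v adj))"

definition encode_graph :: "nat list list \<Rightarrow> nat list" where
  "encode_graph adj =
     length adj # map (list_start adj) [0..<length adj + 1] @ concat adj"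

text \<open>
  The last conjunct restricts the machine to words of \<open>O(log (n + m))\<close> bits: the values
  stay below a fixed power of the input size, so unit cost is not abused by large numbers.
  The summands \<open>1\<close> and \<open>2\<close> only serve the graphs with \<open>n + m \<le> 1\<close>.
\<close>

definition linear_time_recognizable :: "(nat set \<Rightarrow> nat set set \<Rightarrow> bool) \<Rightarrow> bool" where
  "linear_time_recognizable Q \<longleftrightarrow>
     (\<exists>P c k. \<forall>n E adj. simple_graph {..<n} E \<longrightarrow> adjacency_lists n E adj \<longrightarrow>
        (\<exists>t \<le> c * (n + card E + 1).
           halted P (run P t (initial_config (encode_graph adj))) \<and>
           (accepting (run P t (initial_config (encode_graph adj))) \<longleftrightarrow> Q {..<n} E) \<and>
           (\<forall>t'\<le>t. values_below ((n + card E + 2) ^ k)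
                      (run P t' (initial_config (encode_graph adj))))))"

end

theory Submission
  imports Defs
begin

text \<open>
  Call a graph layered if its vertices can be labelled so that adjacent vertices have the same
  label and the vertices of each label split into a part \<open>K\<close>, in which any two vertices are
  adjacent or have the same neighbourhood, and a rest whose neighbourhoods form a chain. In such
  a label class no edge has both ends outside \<open>K\<close>, so every vertex of \<open>K\<close> ve-dominates
  all its edges; and among vertices outside \<open>K\<close> the one with the largest neighbourhood
  ve-dominates whatever the others do. A minimal ve-dominating set therefore contains exactly one
  vertex from each label class with an edge, and the graph is well-ve-dominated. Induced
  subgraphs inherit the layering (\<open>layered_imp_perfectly_well_ve_dominated\<close>).

  Conversely, three graphs have minimal ve-dominating sets of sizes one and two: the path
  \<open>P4\<close>, the butterfly (two triangles sharing a vertex), and the join of two copies of the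
  complement of \<open>P3\<close>. Without an induced \<open>P4\<close> or butterfly, nonadjacent vertices of a
  component have comparable neighbourhoods (\<open>comparable\<close>). Without the third graph, the
  vertices that have a nonneighbour of larger degree in their component are pairwise
  nonadjacent (\<open>below_nonadjacent\<close>), and hence their neighbourhoods form a chain in each
  component.

  The recognition algorithm builds a layering while it scans the vertices by decreasing degree. It
  propagates component labels from each scanned vertex \<open>v\<close> to its neighbours and looks for
  the first scanned vertex \<open>x\<close> with the label of \<open>v\<close> that is not a neighbour of
  \<open>v\<close>. If \<open>x\<close> and \<open>v\<close> have equal degrees, they must have the same
  neighbourhood; otherwise the neighbourhood of \<open>v\<close> must be contained in that of the
  previous vertex of this second kind with the same label. If all tests succeed, the graph is
  layered (\<open>good_imp_layered\<close>), and if none of the three graphs is induced, all tests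
  succeed (\<open>sorted_imp_good\<close>). Each vertex costs time linear in its degree: the search for
  \<open>x\<close> passes only neighbours of \<open>v\<close>, the first test reads a list as long as that of
  \<open>v\<close>, and the second one reads stamps that the previous vertex left on its neighbours.

  For the machine, the scan is written in a small structured language whose values are only
  vertices, labels, degrees and flags. After a prologue that computes the base addresses of the
  arrays, all addresses occur inside the code of single operations, where \<open>op_correct\<close> bounds
  them. The judgement \<open>runs\<close> states that a program ends within a given number of steps in a
  state with a given property; its rules reduce the running time to a sum over the vertices.
\<close>

section \<open>Layered graphs\<close>

definition nbs :: "'a set set \<Rightarrow> 'a \<Rightarrow> 'a set" where
  "nbs E v = {u. {v, u} \<in> E}"

text \<open>
  The labels are meant as names of components, but a label class may also be a union of components;
  this keeps the notion closed under induced subgraphs.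
\<close>

definition layered :: "'a set \<Rightarrow> ('a \<Rightarrow> 'a set) \<Rightarrow> ('a \<Rightarrow> 'b) \<Rightarrow> 'a set \<Rightarrow> bool" where
  "layered V N c K \<longleftrightarrow>
     (\<forall>v\<in>V. \<forall>u\<in>N v. c u = c v) \<and>
     (\<forall>u\<in>V. \<forall>v\<in>V. c u = c v \<longrightarrow> u \<in> K \<longrightarrow> v \<in> K \<longrightarrow> u \<in> N v \<or> N u = N v) \<and>
     (\<forall>u\<in>V. \<forall>v\<in>V. c u = c v \<longrightarrow> u \<notin> K \<longrightarrow> v \<notin> K \<longrightarrow> N u \<subseteq> N v \<or> N v \<subseteq> N u)"

definition dominates_edge :: "('a \<Rightarrow> 'a set) \<Rightarrow> 'a \<Rightarrow> 'a \<Rightarrow> 'a \<Rightarrow> bool" where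
  "dominates_edge N v x y \<longleftrightarrow> x = v \<or> y = v \<or> x \<in> N v \<or> y \<in> N v"

lemma nbs_sym: "u \<in> nbs E v \<longleftrightarrow> v \<in> nbs E u"
  by (simp add: nbs_def insert_commute)

lemma nbs_simple:
  assumes "simple_graph V E" "u \<in> nbs E v"
  shows "u \<in> V" "v \<in> V" "u \<noteq> v"
  using assms by (auto simp: nbs_def simple_graph_def)

lemma simple_edgeE:
  assumes "simple_graph V E" "e \<in> E"
  obtains x y where "e = {x, y}" "y \<in> nbs E x" "x \<noteq> y" "x \<in> V" "y \<in> V"
proof -
  have "card e = 2" "e \<subseteq> V" using assms by (auto simp: simple_graph_def)
  then obtain x y where "e = {x, y}" "x \<noteq> y" by (auto simp: card_2_iff)
  then show thesis using that assms \<open>e \<subseteq> V\<close> by (auto simp: nbs_def)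
qed

lemma ve_dominates_pair:
  "ve_dominates E v {x, y} \<longleftrightarrow> dominates_edge (nbs E) v x y"
  by (auto simp: ve_dominates_def closed_neighborhood_def dominates_edge_def nbs_def)

lemma ve_dominating_set_iff:
  assumes "simple_graph V E"
  shows "ve_dominating_set V E D \<longleftrightarrow>
    D \<subseteq> V \<and> (\<forall>x y. y \<in> nbs E x \<longrightarrow> (\<exists>v\<in>D. dominates_edge (nbs E) v x y))"
proof -
  have "(\<forall>e\<in>E. \<exists>v\<in>D. ve_dominates E v e) \<longleftrightarrow>
     (\<forall>x y. y \<in> nbs E x \<longrightarrow> (\<exists>v\<in>D. dominates_edge (nbs E) v x y))"
    (is "?L \<longleftrightarrow> ?R")
  proof
    assume ?L
    then show ?R by (auto simp: nbs_def simp flip: ve_dominates_pair)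
  next
    assume R: ?R
    show ?L
    proof
      fix e assume "e \<in> E"
      then obtain x y where "e = {x, y}" "y \<in> nbs E x" using simple_edgeE[OF assms] by metis
      then show "\<exists>v\<in>D. ve_dominates E v e" using R by (simp add: ve_dominates_pair)
    qed
  qed
  then show ?thesis by (auto simp: ve_dominating_set_def)
qed

lemma simple_graph_induced:
  "simple_graph V E \<Longrightarrow> S \<subseteq> V \<Longrightarrow> simple_graph S (induced_edges E S)"
  by (auto simp: simple_graph_def induced_edges_def intro: finite_subset)

lemma nbs_induced:
  "nbs (induced_edges E S) v = (if v \<in> S then nbs E v \<inter> S else {})"
  by (auto simp: nbs_def induced_edges_def)

lemma layered_induced:
  assumes "layered V (nbs E) c K" "S \<subseteq> V"
  shows "layered S (nbs (induced_edges E S)) c K"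
  unfolding layered_def nbs_induced
proof (intro conjI ballI impI)
  fix v u assume "v \<in> S" "u \<in> (if v \<in> S then nbs E v \<inter> S else {})"
  then show "c u = c v" using assms by (auto simp: layered_def)
next
  fix u v assume "u \<in> S" "v \<in> S" "c u = c v" "u \<in> K" "v \<in> K"
  then have "u \<in> nbs E v \<or> nbs E u = nbs E v" using assms unfolding layered_def by blast
  then show "u \<in> (if v \<in> S then nbs E v \<inter> S else {}) \<or>
      (if u \<in> S then nbs E u \<inter> S else {}) = (if v \<in> S then nbs E v \<inter> S else {})"
    using \<open>u \<in> S\<close> \<open>v \<in> S\<close> by auto
next
  fix u v assume "u \<in> S" "v \<in> S" "c u = c v" "u \<notin> K" "v \<notin> K"
  then have "nbs E u \<subseteq> nbs E v \<or> nbs E v \<subseteq> nbs E u" using assms unfolding layered_def by blast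
  then show "(if u \<in> S then nbs E u \<inter> S else {}) \<subseteq> (if v \<in> S then nbs E v \<inter> S else {}) \<or>
      (if v \<in> S then nbs E v \<inter> S else {}) \<subseteq> (if u \<in> S then nbs E u \<inter> S else {})"
    using \<open>u \<in> S\<close> \<open>v \<in> S\<close> by auto
qed

text \<open>
  If the dominating set meets \<open>K\<close> in the label class, any vertex there will do: every edge has an
  end in \<open>K\<close>, and this end is adjacent to the vertex or a twin of it. Otherwise the vertex with the
  largest neighbourhood takes over the work of all the others.
\<close>

lemma layered_dominator:
  assumes G: "simple_graph V E" and L: "layered V (nbs E) c K"
    and D: "ve_dominating_set V E D" and xy: "y \<in> nbs E x"
  obtains v where "v \<in> D" "c v = c x"
    "\<And>a b. b \<in> nbs E a \<Longrightarrow> c a = c x \<Longrightarrow> dominates_edge (nbs E) v a b"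
proof -
  let ?N = "nbs E"
  have DV: "D \<subseteq> V" using D by (simp add: ve_dominating_set_def)
  have lab: "c u = c v" if "u \<in> ?N v" for u v
    using L that nbs_simple[OF G that] by (auto simp: layered_def)
  define Dc where "Dc = {v \<in> D. c v = c x}"
  have dom: "\<exists>v\<in>Dc. dominates_edge ?N v a b" if "b \<in> ?N a" "c a = c x" for a b
  proof -
    obtain v where v: "v \<in> D" "dominates_edge ?N v a b"
      using D \<open>b \<in> ?N a\<close> unfolding ve_dominating_set_iff[OF G] by blast
    then have "c v = c x"
      using lab[OF \<open>b \<in> ?N a\<close>] \<open>c a = c x\<close> by (auto simp: dominates_edge_def dest: lab)
    then show ?thesis using v by (auto simp: Dc_def)
  qed
  have Dc: "finite Dc" "Dc \<noteq> {}"
    using dom[OF xy] DV G by (auto simp: Dc_def simple_graph_def intro: finite_subset)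
  have fN: "finite (?N s)" for s
    using G nbs_simple[OF G] by (auto simp: simple_graph_def intro: finite_subset[of _ V])
  show thesis
  proof (cases "Dc \<inter> K = {}")
    case False
    then obtain v where v: "v \<in> D" "c v = c x" "v \<in> K" "v \<in> V" using DV by (auto simp: Dc_def)
    have "dominates_edge ?N v a b" if ab: "b \<in> ?N a" and "c a = c x" for a b
    proof -
      have V: "a \<in> V" "b \<in> V" "a \<noteq> b" using nbs_simple[OF G ab] by auto
      have cb: "c b = c x" using lab[OF ab] \<open>c a = c x\<close> by simp
      have ba: "a \<in> ?N b" using ab nbs_sym by metis
      \<comment> \<open>two adjacent vertices never have comparable neighbourhoods\<close>
      have "a \<in> K \<or> b \<in> K"
      proof (rule ccontr)
        assume "\<not> (a \<in> K \<or> b \<in> K)"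
        then have "?N a \<subseteq> ?N b \<or> ?N b \<subseteq> ?N a"
          using L V cb \<open>c a = c x\<close> unfolding layered_def by simp
        then show False using ab ba nbs_simple(3)[OF G] by blast
      qed
      then show ?thesis
      proof
        assume "a \<in> K"
        then have "a \<in> ?N v \<or> ?N a = ?N v"
          using L V v \<open>c a = c x\<close> unfolding layered_def by simp
        then show ?thesis using ab by (auto simp: dominates_edge_def)
      next
        assume "b \<in> K"
        then have "b \<in> ?N v \<or> ?N b = ?N v"
          using L V v cb unfolding layered_def by simp
        then show ?thesis using ba by (auto simp: dominates_edge_def)
      qed
    qed
    then show thesis using that v by blast
  next
    case True
    define s where "s = arg_max (\<lambda>d. card (?N d)) (\<lambda>d. d \<in> Dc)"
    have "\<forall>d. d \<in> Dc \<longrightarrow> card (?N d) \<le> Max ((\<lambda>d. card (?N d)) ` Dc)"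
      using Dc by auto
    then have s: "s \<in> Dc" "\<And>d. d \<in> Dc \<Longrightarrow> card (?N d) \<le> card (?N s)"
      using arg_max_nat_lemma[of "\<lambda>d. d \<in> Dc" _ "\<lambda>d. card (?N d)"] Dc(2)
      unfolding s_def by (metis le_imp_less_Suc ex_in_conv)+
    have sub: "?N d \<subseteq> ?N s" if "d \<in> Dc" for d
    proof -
      have "?N d \<subseteq> ?N s \<or> ?N s \<subseteq> ?N d"
      proof -
        have "d \<in> V" "s \<in> V" "c d = c s" "d \<notin> K" "s \<notin> K"
          using that s(1) True DV by (auto simp: Dc_def)
        then show ?thesis using L unfolding layered_def by blast
      qed
      then show ?thesis using s(2)[OF that] fN card_seteq by (metis order_refl)
    qed
    have "dominates_edge ?N s a b" if ab: "b \<in> ?N a" and "c a = c x" for a b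
    proof -
      obtain d where d: "d \<in> Dc" "dominates_edge ?N d a b"
        using dom[OF ab \<open>c a = c x\<close>] by blast
      have "a \<in> ?N b" using ab nbs_sym by metis
      then show ?thesis using d(2) sub[OF d(1)] ab by (auto simp: dominates_edge_def)
    qed
    then show thesis using that s(1) by (auto simp: Dc_def)
  qed
qed

text \<open>
  One dominator for each label class with an edge already forms a ve-dominating set. By minimality
  there are no further vertices, so the size is the number of these classes.
\<close>

lemma layered_imp_well_ve_dominated:
  assumes G: "simple_graph V E" and L: "layered V (nbs E) c K"
  shows "well_ve_dominated V E"
proof -
  have "card D = card (c ` \<Union>E)" if min: "minimal_ve_dominating_set V E D" for D
  proof -
    have D: "ve_dominating_set V E D" using min by (simp add: minimal_ve_dominating_set_def)
    have "\<exists>v. v \<in> D \<and> c v = l \<and> (\<forall>a b. b \<in> nbs E a \<longrightarrow> c a = l \<longrightarrow> dominates_edge (nbs E) v a b)"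
      if "l \<in> c ` \<Union>E" for l
    proof -
      obtain x where x: "x \<in> \<Union>E" "l = c x" using \<open>l \<in> c ` \<Union>E\<close> by (rule imageE) blast
      then obtain e where e: "e \<in> E" "x \<in> e" by blast
      obtain p q where pq: "e = {p, q}" "q \<in> nbs E p" by (rule simple_edgeE[OF G \<open>e \<in> E\<close>])
      then have "q \<in> nbs E p" "p \<in> nbs E q" using nbs_sym by metis+
      then obtain y where "y \<in> nbs E x" using pq e(2) by auto
      then show ?thesis using layered_dominator[OF G L D, of y x] x(2) by metis
    qed
    then obtain f where f: "\<And>l. l \<in> c ` \<Union>E \<Longrightarrow> f l \<in> D"
      "\<And>l. l \<in> c ` \<Union>E \<Longrightarrow> c (f l) = l"
      "\<And>l a b. l \<in> c ` \<Union>E \<Longrightarrow> b \<in> nbs E a \<Longrightarrow> c a = l \<Longrightarrow> dominates_edge (nbs E) (f l) a b"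
      by metis
    define D' where "D' = f ` c ` \<Union>E"
    have sub: "D' \<subseteq> D" using f(1) unfolding D'_def by blast
    have "ve_dominating_set V E D'"
      unfolding ve_dominating_set_iff[OF G]
    proof (intro conjI allI impI)
      show "D' \<subseteq> V" using sub D by (auto simp: ve_dominating_set_def)
      fix x y assume xy: "y \<in> nbs E x"
      then have "x \<in> \<Union>E" by (auto simp: nbs_def)
      then show "\<exists>v\<in>D'. dominates_edge (nbs E) v x y" using f(3)[OF _ xy refl] unfolding D'_def by blast
    qed
    then have "\<not> D' \<subset> D" using min unfolding minimal_ve_dominating_set_def by metis
    then have "D' = D" using sub by blast
    moreover have "inj_on f (c ` \<Union>E)"
    proof (rule inj_onI)
      fix k l assume kl: "k \<in> c ` \<Union>E" "l \<in> c ` \<Union>E" "f k = f l"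
      have "k = c (f k)" by (rule f(2)[OF kl(1), symmetric])
      also have "\<dots> = c (f l)" by (simp only: kl(3))
      also have "\<dots> = l" by (rule f(2)[OF kl(2)])
      finally show "k = l" .
    qed
    then have "card D' = card (c ` \<Union>E)" unfolding D'_def by (rule card_image)
    ultimately show ?thesis by simp
  qed
  then show ?thesis by (simp add: well_ve_dominated_def)
qed

theorem layered_imp_perfectly_well_ve_dominated:
  assumes "simple_graph V E" "layered V (nbs E) c K"
  shows "perfectly_well_ve_dominated V E"
  unfolding perfectly_well_ve_dominated_def
  using layered_imp_well_ve_dominated simple_graph_induced[OF assms(1)] layered_induced[OF assms(2)]
  by metis

section \<open>Obstructions\<close>

definition P4_free :: "('a \<Rightarrow> 'a set) \<Rightarrow> bool" where
  "P4_free N \<longleftrightarrow> (\<forall>a b c d. b \<in> N a \<longrightarrow> c \<in> N b \<longrightarrow> d \<in> N c \<longrightarrow> c \<in> N a \<or> d \<in> N b \<or> d \<in> N a)"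

definition butterfly_free :: "('a \<Rightarrow> 'a set) \<Rightarrow> bool" where
  "butterfly_free N \<longleftrightarrow>
     (\<forall>z a b c d. {a, b, c, d} \<subseteq> N z \<longrightarrow> b \<in> N a \<longrightarrow> d \<in> N c \<longrightarrow>
        c \<in> N a \<or> d \<in> N a \<or> c \<in> N b \<or> d \<in> N b)"

text \<open>
  The excluded graph is the join of \<open>{v, x, y}\<close> and \<open>{s, x', y'}\<close>, each of which induces one
  edge and one isolated vertex, the complement of a path on three vertices.
\<close>

definition co_P3_join_free :: "('a \<Rightarrow> 'a set) \<Rightarrow> bool" where
  "co_P3_join_free N \<longleftrightarrow>
     (\<forall>v x y s x' y'. y \<in> N x \<longrightarrow> y' \<in> N x' \<longrightarrow> {s, x', y'} \<subseteq> N v \<inter> N x \<inter> N y \<longrightarrow>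
        x \<in> N v \<or> y \<in> N v \<or> x' \<in> N s \<or> y' \<in> N s)"

text \<open>
  The common pattern of all obstructions: in the graph induced by \<open>S\<close>, the single vertex \<open>r\<close> and
  the pair \<open>{p, q}\<close> are minimal ve-dominating sets of different sizes.
\<close>

lemma perfectly_single_pair:
  assumes G: "simple_graph V E" and P: "perfectly_well_ve_dominated V E" and S: "S \<subseteq> V"
    and mem: "p \<in> S" "q \<in> S" "r \<in> S" "p \<noteq> q"
    and one: "\<And>x y. x \<in> S \<Longrightarrow> y \<in> S \<Longrightarrow> y \<in> nbs E x \<Longrightarrow> dominates_edge (nbs E) r x y"
    and two: "\<And>x y. x \<in> S \<Longrightarrow> y \<in> S \<Longrightarrow> y \<in> nbs E x \<Longrightarrow>
        dominates_edge (nbs E) p x y \<or> dominates_edge (nbs E) q x y"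
    and ab: "a \<in> S" "b \<in> S" "b \<in> nbs E a" "\<not> dominates_edge (nbs E) p a b"
    and cd: "c \<in> S" "d \<in> S" "d \<in> nbs E c" "\<not> dominates_edge (nbs E) q c d"
  shows False
proof -
  let ?E = "induced_edges E S"
  have G': "simple_graph S ?E" using simple_graph_induced[OF G S] .
  have edge: "y \<in> nbs ?E x \<longleftrightarrow> x \<in> S \<and> y \<in> S \<and> y \<in> nbs E x" for x y
    by (auto simp: nbs_induced)
  have dom: "dominates_edge (nbs ?E) v x y \<longleftrightarrow> dominates_edge (nbs E) v x y"
    if "v \<in> S" "x \<in> S" "y \<in> S" for v x y
    using that by (auto simp: dominates_edge_def edge)
  have ds: "ve_dominating_set S ?E D \<longleftrightarrow>
      (\<forall>x\<in>S. \<forall>y\<in>S. y \<in> nbs E x \<longrightarrow> (\<exists>v\<in>D. dominates_edge (nbs E) v x y))" if "D \<subseteq> S" for D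
    unfolding ve_dominating_set_iff[OF G'] using that dom by (auto simp: edge subset_iff)
  have "minimal_ve_dominating_set S ?E {r}"
    unfolding minimal_ve_dominating_set_def
  proof (intro conjI allI impI)
    show "ve_dominating_set S ?E {r}" using one mem by (simp add: ds)
    fix D' assume "D' \<subset> {r}"
    then have "D' = {}" by auto
    then show "\<not> ve_dominating_set S ?E D'" using ab by (auto simp: ds)
  qed
  moreover have "minimal_ve_dominating_set S ?E {p, q}"
    unfolding minimal_ve_dominating_set_def
  proof (intro conjI allI impI)
    show "ve_dominating_set S ?E {p, q}" using two mem by (auto simp: ds)
    fix D' assume "D' \<subset> {p, q}"
    then have "D' \<subseteq> {p} \<or> D' \<subseteq> {q}" by auto
    then show "\<not> ve_dominating_set S ?E D'"
      using ab cd mem by (subst ds) (auto 0 4)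
  qed
  ultimately have "card {r} = card {p, q}"
    using P S unfolding perfectly_well_ve_dominated_def well_ve_dominated_def by blast
  then show False using \<open>p \<noteq> q\<close> by simp
qed

text \<open>
  An inner vertex dominates all three edges; the two ends dominate them only together.
\<close>

lemma perfectly_imp_P4_free:
  assumes G: "simple_graph V E" and P: "perfectly_well_ve_dominated V E"
  shows "P4_free (nbs E)"
  unfolding P4_free_def
proof (intro allI impI, rule ccontr)
  fix a b c d
  assume *: "b \<in> nbs E a" "c \<in> nbs E b" "d \<in> nbs E c"
    "\<not> (c \<in> nbs E a \<or> d \<in> nbs E b \<or> d \<in> nbs E a)"
  note ir = nbs_simple[OF G]
  have sy: "u \<in> nbs E v \<Longrightarrow> v \<in> nbs E u" for u v using nbs_sym by metis
  have not_self: "v \<notin> nbs E v" for v using ir(3) by blast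
  have "a \<noteq> c" "b \<noteq> d" "a \<noteq> d" "a \<noteq> b" "b \<noteq> c" "c \<noteq> d" using * ir sy by metis+
  then show False using * ir(1,2) sy not_self
    by (intro perfectly_single_pair[OF G P, of "{a,b,c,d}" a d b c d a b])
      (auto simp: dominates_edge_def)
qed

text \<open>
  The centre dominates everything; any other vertex misses the edge opposite to the centre in the
  triangle that does not contain it.
\<close>

lemma perfectly_imp_butterfly_free:
  assumes G: "simple_graph V E" and P: "perfectly_well_ve_dominated V E"
  shows "butterfly_free (nbs E)"
  unfolding butterfly_free_def
proof (intro allI impI, rule ccontr)
  fix z a b c d
  assume *: "{a, b, c, d} \<subseteq> nbs E z" "b \<in> nbs E a" "d \<in> nbs E c"
    "\<not> (c \<in> nbs E a \<or> d \<in> nbs E a \<or> c \<in> nbs E b \<or> d \<in> nbs E b)"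
  note ir = nbs_simple[OF G]
  have sy: "u \<in> nbs E v \<Longrightarrow> v \<in> nbs E u" for u v using nbs_sym by metis
  have not_self: "v \<notin> nbs E v" for v using ir(3) by blast
  have "a \<noteq> c" "a \<noteq> d" "b \<noteq> c" "b \<noteq> d" "a \<noteq> b" "c \<noteq> d" "z \<noteq> a" "z \<noteq> b" "z \<noteq> c" "z \<noteq> d"
    using * ir(3) sy by blast+
  then show False using * ir(1,2) sy not_self
    by (intro perfectly_single_pair[OF G P, of "{z,a,b,c,d}" a c z c d a b])
      (auto simp: dominates_edge_def)
qed

text \<open>
  An end of one of the two edges dominates everything; the isolated vertices of the two parts each
  miss only the edge of their own part.
\<close>

lemma perfectly_imp_co_P3_join_free:
  assumes G: "simple_graph V E" and P: "perfectly_well_ve_dominated V E"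
  shows "co_P3_join_free (nbs E)"
  unfolding co_P3_join_free_def
proof (intro allI impI, rule ccontr)
  fix v x y s x' y'
  assume *: "y \<in> nbs E x" "y' \<in> nbs E x'" "{s, x', y'} \<subseteq> nbs E v \<inter> nbs E x \<inter> nbs E y"
    "\<not> (x \<in> nbs E v \<or> y \<in> nbs E v \<or> x' \<in> nbs E s \<or> y' \<in> nbs E s)"
  note ir = nbs_simple[OF G]
  have sy: "u \<in> nbs E v \<Longrightarrow> v \<in> nbs E u" for u v using nbs_sym by metis
  have not_self: "v \<notin> nbs E v" for v using ir(3) by blast
  have 1: "s \<in> nbs E v" "s \<in> nbs E x" "s \<in> nbs E y" "x' \<in> nbs E v" "x' \<in> nbs E x" "x' \<in> nbs E y"
    "y' \<in> nbs E v" "y' \<in> nbs E x" "y' \<in> nbs E y" using * by auto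
  have 2: "v \<noteq> x" "v \<noteq> y" "s \<noteq> x'" "s \<noteq> y'" using * 1 sy by blast+
  have 3: "v \<in> V" "x \<in> V" "y \<in> V" "s \<in> V" "x' \<in> V" "y' \<in> V" using 1 ir by blast+
  have 4: "v \<noteq> s" "v \<noteq> x'" "v \<noteq> y'" "x \<noteq> s" "x \<noteq> x'" "x \<noteq> y'" "y \<noteq> s" "y \<noteq> x'" "y \<noteq> y'"
    using 1 ir(3) by metis+
  have 5: "x \<notin> nbs E v" "y \<notin> nbs E v" "x' \<notin> nbs E s" "y' \<notin> nbs E s" "v \<notin> nbs E x" "v \<notin> nbs E y"
    using * sy by blast+
  show False
  proof (rule perfectly_single_pair[OF G P, of "{v,x,y,s,x',y'}" v s x x y x' y'])
    show "dominates_edge (nbs E) x a b"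
      if "a \<in> {v,x,y,s,x',y'}" "b \<in> {v,x,y,s,x',y'}" "b \<in> nbs E a" for a b
      using that 1 5 *(1) ir(3) by (auto simp: dominates_edge_def)
    show "dominates_edge (nbs E) v a b \<or> dominates_edge (nbs E) s a b"
      if "a \<in> {v,x,y,s,x',y'}" "b \<in> {v,x,y,s,x',y'}" "b \<in> nbs E a" for a b
      using that 1 sy ir(3) by (auto simp: dominates_edge_def)
  qed (use * 1 2 3 4 5 sy in \<open>auto simp: dominates_edge_def\<close>)
qed

locale obstruction_free =
  fixes N :: "'a \<Rightarrow> 'a set"
  assumes sym: "u \<in> N v \<Longrightarrow> v \<in> N u"
    and irrefl: "v \<notin> N v"
    and P4: "P4_free N"
    and butterfly: "butterfly_free N"
    and co_P3_join: "co_P3_join_free N"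
begin

text \<open>
  Distance at most two, which is the same as connectedness if no \<open>P4\<close> is induced.
\<close>

definition conn :: "'a \<Rightarrow> 'a \<Rightarrow> bool" where
  "conn u v \<longleftrightarrow> u = v \<or> u \<in> N v \<or> (\<exists>w. w \<in> N u \<and> w \<in> N v)"

lemma no_P4: "b \<in> N a \<Longrightarrow> c \<in> N b \<Longrightarrow> d \<in> N c \<Longrightarrow> c \<in> N a \<or> d \<in> N b \<or> d \<in> N a"
  using P4 unfolding P4_free_def by blast

lemma conn_sym: "conn u v \<Longrightarrow> conn v u"
  using sym by (auto simp: conn_def)

lemma conn_step: "conn u v \<Longrightarrow> w \<in> N v \<Longrightarrow> conn u w"
  unfolding conn_def using no_P4 sym by metis

lemma conn_trans: "conn u v \<Longrightarrow> conn v w \<Longrightarrow> conn u w"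
  using conn_step sym unfolding conn_def[of v w] by metis

text \<open>
  Private neighbours \<open>a\<close> of \<open>u\<close> and \<open>b\<close> of \<open>v\<close> are not adjacent, or \<open>u a b v\<close> would be a path. A
  common neighbour \<open>z\<close> must then be adjacent to both of them, and \<open>z\<close> is the centre of a butterfly.
\<close>

lemma comparable:
  assumes "conn u v" "u \<notin> N v"
  shows "N u \<subseteq> N v \<or> N v \<subseteq> N u"
proof (rule ccontr)
  assume "\<not> ?thesis"
  then obtain a b where ab: "a \<in> N u" "a \<notin> N v" "b \<in> N v" "b \<notin> N u" by blast
  then obtain z where z: "z \<in> N u" "z \<in> N v" using assms by (auto simp: conn_def)
  have nab: "b \<notin> N a" using no_P4[of a u b v] ab assms sym by metis
  have "z \<in> N a" using no_P4[of u a z v] ab assms sym z by metis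
  moreover have "z \<in> N b" using no_P4[of v b z u] ab assms sym z by metis
  ultimately have "{u, a, v, b} \<subseteq> N z" using sym z by blast
  then show False
    using butterfly ab nab assms sym unfolding butterfly_free_def by metis
qed

text \<open>
  If \<open>v\<close> and \<open>s\<close> were adjacent, then \<open>x\<close> with a private neighbour \<open>y\<close> over \<open>v\<close>, and \<open>x'\<close> with a
  private neighbour \<open>y'\<close> over \<open>s\<close>, would complete them to a join of two complements of \<open>P3\<close>.
\<close>

lemma below_nonadjacent:
  assumes v: "conn x v" "x \<notin> N v" "\<not> N x \<subseteq> N v"
    and s: "conn x' s" "x' \<notin> N s" "\<not> N x' \<subseteq> N s"
  shows "v \<notin> N s"
proof
  assume vs: "v \<in> N s"
  have Nv: "N v \<subseteq> N x" using comparable v by blast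
  have Ns: "N s \<subseteq> N x'" using comparable s by blast
  obtain y y' where y: "y \<in> N x" "y \<notin> N v" and y': "y' \<in> N x'" "y' \<notin> N s" using v s by blast
  have sv: "s \<in> N v" using sym vs .
  have sx: "s \<in> N x" "v \<in> N x'" using Nv Ns sv vs by auto
  \<comment> \<open>nonadjacent vertices with the private neighbours \<open>s\<close> and \<open>v\<close> would be incomparable\<close>
  have cross: "p \<in> N q" if "s \<in> N p" "s \<notin> N q" "v \<in> N q" "v \<notin> N p" for p q
  proof (rule ccontr)
    assume "p \<notin> N q"
    moreover have "conn p q" using that vs conn_step sym unfolding conn_def by metis
    ultimately show False using comparable that by blast
  qed
  have sy: "s \<in> N y" using no_P4[of s v x y] y v sx sv sym vs by metis
  have vy': "v \<in> N y'" using no_P4[of v s x' y'] y' s sx sv sym vs by metis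
  have "x' \<in> N x" "y' \<in> N x" "x' \<in> N y" "y' \<in> N y"
    using cross sx sy vy' v(2) s(2) y(2) y'(2) sym by metis+
  then have "{s, x', y'} \<subseteq> N v \<inter> N x \<inter> N y"
    using sx sy vy' sv sym by blast
  then show False using co_P3_join y y' v s sym unfolding co_P3_join_free_def by metis
qed

end

section \<open>Scanning the vertices by decreasing degree\<close>

text \<open>
  Vertices are numbered from \<open>1\<close>, so that \<open>0\<close> can stand for an absent label or vertex. The label of
  a class is its first scanned vertex. For a label, \<open>chain\<close> is the last vertex that was tested
  against the chain of neighbourhoods, and it has left its number in \<open>stamp\<close> at all its neighbours.
\<close>

record scan_state =
  visited :: "nat list"
  label :: "nat \<Rightarrow> nat"
  stamp :: "nat \<Rightarrow> nat"
  chain :: "nat \<Rightarrow> nat"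
  good :: bool

definition rep :: "(nat \<Rightarrow> nat set) \<Rightarrow> (nat \<Rightarrow> nat) \<Rightarrow> nat list \<Rightarrow> nat \<Rightarrow> nat" where
  "rep N lab xs v = hd (filter (\<lambda>w. lab w = lab v \<and> w \<notin> N v) xs)"

text \<open>
  One neighbour suffices to find an existing label: in a graph without the obstructions, once a vertex
  of at least the same degree in the component of \<open>v\<close> has been scanned, \<open>v\<close> itself or each of its
  neighbours is labelled.
\<close>

definition start_label :: "(nat \<Rightarrow> nat list) \<Rightarrow> (nat \<Rightarrow> nat) \<Rightarrow> nat \<Rightarrow> nat" where
  "start_label nb lab v =
     (if lab v \<noteq> 0 then lab v else if lab (hd (nb v)) \<noteq> 0 then lab (hd (nb v)) else v)"

definition spread_label :: "(nat \<Rightarrow> nat list) \<Rightarrow> (nat \<Rightarrow> nat) \<Rightarrow> nat \<Rightarrow> nat \<Rightarrow> nat" where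
  "spread_label nb lab v =
     (\<lambda>u. if u = v \<or> (u \<in> set (nb v) \<and> lab u = 0) then start_label nb lab v else lab u)"

text \<open>
  The state is also updated after a failed test, so that the running time can be analysed without
  regard to the outcome of the tests.
\<close>

definition scan :: "(nat \<Rightarrow> nat list) \<Rightarrow> nat \<Rightarrow> scan_state \<Rightarrow> scan_state" where
  "scan nb v s =
     (let l = start_label nb (label s) v; lab = spread_label nb (label s) v; xs = visited s @ [v];
          x = rep (set \<circ> nb) lab xs v;
          ok = (good s \<and> (\<forall>u\<in>set (nb v). label s u = 0 \<or> label s u = l))
      in if length (nb x) = length (nb v)
         then s\<lparr>visited := xs, label := lab, good := ok \<and> set (nb x) \<subseteq> set (nb v)\<rparr>
         else s\<lparr>visited := xs, label := lab,
                stamp := (\<lambda>u. if u \<in> set (nb v) then v else stamp s u),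
                chain := (chain s)(l := v),
                good := ok \<and> (\<forall>u\<in>set (nb v). stamp s u = chain s l)\<rparr>)"

definition scan_init :: scan_state where
  "scan_init = \<lparr>visited = [], label = \<lambda>_. 0, stamp = \<lambda>_. 0, chain = \<lambda>_. 0, good = True\<rparr>"

locale neighbour_lists =
  fixes nb :: "nat \<Rightarrow> nat list"
  assumes nb_sym: "u \<in> set (nb v) \<Longrightarrow> v \<in> set (nb u)"
    and nb_irrefl: "v \<notin> set (nb v)"
    and nb_distinct: "distinct (nb v)"
    and nb_zero: "nb 0 = []"
begin

abbreviation N :: "nat \<Rightarrow> nat set" where "N \<equiv> set \<circ> nb"
abbreviation deg :: "nat \<Rightarrow> nat" where "deg v \<equiv> length (nb v)"

lemma deg_card: "deg v = card (N v)"
  using distinct_card[OF nb_distinct] by simp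

lemma subset_degree_eq: "N x \<subseteq> N v \<Longrightarrow> deg x \<ge> deg v \<Longrightarrow> N x = N v"
  using card_seteq[of "N v" "N x"] by (simp add: deg_card)

lemma visited_scan [simp]: "visited (scan nb v s) = visited s @ [v]"
  by (simp add: scan_def Let_def)

lemma label_scan: "label (scan nb v s) = spread_label nb (label s) v"
  by (simp add: scan_def Let_def)

lemma visited_fold: "visited (fold (scan nb) vs s) = visited s @ vs"
  by (induction vs arbitrary: s) auto

lemma rep_in:
  assumes "v \<in> set xs"
  shows "rep N lab xs v \<in> set xs" "lab (rep N lab xs v) = lab v" "rep N lab xs v \<notin> N v"
proof -
  have "v \<in> set (filter (\<lambda>w. lab w = lab v \<and> w \<notin> N v) xs)" using assms nb_irrefl by simp
  then have "filter (\<lambda>w. lab w = lab v \<and> w \<notin> N v) xs \<noteq> []" by (metis empty_iff empty_set)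
  then have "rep N lab xs v \<in> set (filter (\<lambda>w. lab w = lab v \<and> w \<notin> N v) xs)"
    unfolding rep_def by (rule hd_in_set)
  then show "rep N lab xs v \<in> set xs" "lab (rep N lab xs v) = lab v" "rep N lab xs v \<notin> N v"
    by auto
qed

lemma rep_append:
  assumes "v \<in> set xs" "\<And>w. w \<in> set xs \<Longrightarrow> lab' w = lab w"
  shows "rep N lab' (xs @ ys) v = rep N lab xs v"
proof -
  have eq: "filter (\<lambda>w. lab' w = lab' v \<and> w \<notin> N v) xs = filter (\<lambda>w. lab w = lab v \<and> w \<notin> N v) xs"
    using assms by (intro filter_cong) auto
  have "v \<in> set (filter (\<lambda>w. lab w = lab v \<and> w \<notin> N v) xs)" using assms nb_irrefl by simp
  then have "filter (\<lambda>w. lab w = lab v \<and> w \<notin> N v) xs \<noteq> []" by (metis empty_iff empty_set)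
  then show ?thesis unfolding rep_def filter_append eq by (rule hd_append2)
qed

text \<open>
  If the representatives of \<open>u\<close> and \<open>v\<close> differ, the one that comes first, say that of \<open>u\<close>, is adjacent
  to \<open>v\<close>, since \<open>v\<close> has no earlier nonneighbour. Being a twin of its representative, \<open>u\<close> is adjacent
  to \<open>v\<close> too.
\<close>

lemma rep_same_or_adjacent:
  assumes "u \<in> set xs" "v \<in> set xs" "lab u = lab v"
    and "N (rep N lab xs u) = N u" "N (rep N lab xs v) = N v"
  shows "u \<in> N v \<or> N u = N v"
proof -
  let ?P = "\<lambda>z w. lab w = lab z \<and> w \<notin> N z"
  let ?x = "rep N lab xs u" and ?y = "rep N lab xs v"
  have x: "?x \<in> set xs" "lab ?x = lab u" and y: "?y \<in> set xs" "lab ?y = lab v"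
    using rep_in(1,2)[OF assms(1)] rep_in(1,2)[OF assms(2)] by auto
  have first: "\<exists>ys zs. xs = ys @ rep N lab xs z # zs \<and> (\<forall>w\<in>set ys. \<not> ?P z w)"
    if "z \<in> set xs" for z
  proof -
    have "\<exists>w\<in>set xs. ?P z w" using that nb_irrefl[of z] by auto
    from split_list_first_prop[OF this] obtain ys w zs
      where s: "xs = ys @ w # zs" "?P z w" "\<forall>w\<in>set ys. \<not> ?P z w" by blast
    then have "filter (?P z) xs = w # filter (?P z) zs" by simp
    then have "rep N lab xs z = w" by (simp add: rep_def)
    then show ?thesis using s by blast
  qed
  obtain ys zs where u: "xs = ys @ ?x # zs" "\<forall>w\<in>set ys. \<not> ?P u w" using first assms(1) by blast
  obtain ys' zs' where v: "xs = ys' @ ?y # zs'" "\<forall>w\<in>set ys'. \<not> ?P v w"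
    using first assms(2) by blast
  show ?thesis
  proof (cases "?x = ?y")
    case True
    then show ?thesis using assms by metis
  next
    case False
    then have "length ys \<noteq> length ys'" using u(1) v(1) by (metis nth_append_length)
    then have "?x \<in> set ys' \<or> ?y \<in> set ys"
    proof (rule linorder_neqE_nat)
      assume "length ys < length ys'"
      moreover from this have "ys' ! length ys = ?x"
        using u(1) v(1) by (metis nth_append nth_append_length)
      ultimately show ?thesis using nth_mem by metis
    next
      assume "length ys' < length ys"
      moreover from this have "ys ! length ys' = ?y"
        using u(1) v(1) by (metis nth_append nth_append_length)
      ultimately show ?thesis using nth_mem by metis
    qed
    then have "?x \<in> N v \<or> ?y \<in> N u" using u v x y assms(3) by metis
    then show ?thesis using assms(4,5) nb_sym by (metis comp_apply)
  qed
qed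

lemma start_label_nonzero:
  "start_label nb lab v \<noteq> 0" if "v \<noteq> 0"
  using that by (simp add: start_label_def)

lemma label_keep: "label s w \<noteq> 0 \<Longrightarrow> label (scan nb v s) w = label s w"
  by (auto simp: label_scan spread_label_def start_label_def)

lemma label_new: "label (scan nb v s) v = start_label nb (label s) v"
  by (simp add: label_scan spread_label_def)

section \<open>Soundness of the scan\<close>

text \<open>
  A scanned vertex belongs to the part \<open>K\<close> of the layering if it has the same neighbourhood as its
  representative.
  The neighbourhood of the current chain vertex lies below those of all other vertices of its class
  outside \<open>K\<close>.
\<close>

definition sound_invariant :: "scan_state \<Rightarrow> bool" where
  "sound_invariant s \<longleftrightarrow>
     (let R = (\<lambda>v. N (rep N (label s) (visited s) v) = N v) in
      (\<forall>v\<in>set (visited s). label s v \<noteq> 0 \<and> (\<forall>u\<in>N v. label s u = label s v)) \<and>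
      (\<forall>v\<in>set (visited s). R v \<or> chain s (label s v) \<noteq> 0 \<and> N (chain s (label s v)) \<subseteq> N v) \<and>
      (\<forall>u\<in>set (visited s). \<forall>v\<in>set (visited s). label s u = label s v \<longrightarrow> \<not> R u \<longrightarrow> \<not> R v \<longrightarrow>
         N u \<subseteq> N v \<or> N v \<subseteq> N u) \<and>
      (\<forall>u. stamp s u \<noteq> 0 \<longrightarrow> u \<in> N (stamp s u)))"

lemma good_scanD: "good (scan nb v s) \<Longrightarrow> good s"
  by (auto simp: scan_def Let_def split: if_splits)

text \<open>
  A new vertex that passes the test for equal degrees is a twin of its representative. A new vertex
  that passes the chain test has only neighbours stamped by the chain vertex, so it continues the
  chain downwards.
\<close>

lemma sound_step:
  assumes inv: "sound_invariant s" and g: "good (scan nb v s)" and v: "v \<noteq> 0"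
  shows "sound_invariant (scan nb v s)"
proof -
  let ?s = "scan nb v s"
  let ?l = "start_label nb (label s) v"
  define R where "R = (\<lambda>v. N (rep N (label s) (visited s) v) = N v)"
  define R' where "R' = (\<lambda>v. N (rep N (label ?s) (visited ?s) v) = N v)"
  define x where "x = rep N (label ?s) (visited ?s) v"
  have i1: "label s w \<noteq> 0" "u \<in> N w \<Longrightarrow> label s u = label s w" if "w \<in> set (visited s)" for w u
    using inv that unfolding sound_invariant_def Let_def by auto
  have i2: "R w \<or> chain s (label s w) \<noteq> 0 \<and> N (chain s (label s w)) \<subseteq> N w"
    if "w \<in> set (visited s)" for w
    using inv that unfolding sound_invariant_def Let_def R_def by blast
  have i3: "N u \<subseteq> N w \<or> N w \<subseteq> N u"
    if "u \<in> set (visited s)" "w \<in> set (visited s)" "label s u = label s w" "\<not> R u" "\<not> R w" for u w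
    using inv that unfolding sound_invariant_def Let_def R_def by blast
  have i4: "u \<in> N (stamp s u)" if "stamp s u \<noteq> 0" for u
    using inv that unfolding sound_invariant_def Let_def by blast
  have keep: "label ?s w = label s w" if "w \<in> set (visited s)" for w
    using label_keep i1 that by blast
  have R': "R' w = R w" if "w \<in> set (visited s)" for w
    using rep_append[OF that keep] by (simp add: R_def R'_def)
  have lv: "label ?s v = ?l" by (rule label_new)
  have x_eq: "x = rep N (spread_label nb (label s) v) (visited s @ [v]) v"
    by (simp add: x_def label_scan)
  have ok: "\<forall>u\<in>N v. label s u = 0 \<or> label s u = ?l"
    using g by (auto simp: scan_def Let_def split: if_splits)
  have n1: "\<forall>w\<in>set (visited ?s). label ?s w \<noteq> 0 \<and> (\<forall>u\<in>N w. label ?s u = label ?s w)"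
  proof
    fix w assume w: "w \<in> set (visited ?s)"
    show "label ?s w \<noteq> 0 \<and> (\<forall>u\<in>N w. label ?s u = label ?s w)"
    proof (cases "w = v")
      case True
      then show ?thesis
        using lv ok start_label_nonzero[OF v] by (auto simp: label_scan spread_label_def)
    next
      case False
      then have w: "w \<in> set (visited s)" using w by simp
      then show ?thesis using i1[OF w] keep[OF w] label_keep by metis
    qed
  qed
  show ?thesis
  proof (cases "deg x = deg v")
    case True
    have "N x \<subseteq> N v" using g True by (simp add: scan_def Let_def flip: x_eq)
    then have "R' v" using subset_degree_eq True unfolding R'_def x_def by simp
    moreover have "stamp ?s = stamp s" "chain ?s = chain s"
      using True by (simp_all add: scan_def Let_def flip: x_eq)
    ultimately show ?thesis
      unfolding sound_invariant_def Let_def R'_def[THEN fun_cong, symmetric]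
      using n1 i2 i3 i4 R' keep by auto
  next
    case False
    have st: "stamp ?s = (\<lambda>u. if u \<in> set (nb v) then v else stamp s u)"
      and ch: "chain ?s = (chain s)(?l := v)"
      using False by (simp_all add: scan_def Let_def flip: x_eq)
    have eq: "stamp s u = chain s ?l" if "u \<in> N v" for u
      using g False that by (simp add: scan_def Let_def flip: x_eq)
    have sub: "N v \<subseteq> N (chain s ?l)" if "chain s ?l \<noteq> 0"
    proof
      fix u assume "u \<in> N v"
      then show "u \<in> N (chain s ?l)" using eq i4[of u] that by simp
    qed
    have sub': "N v \<subseteq> N w" if "w \<in> set (visited s)" "label s w = ?l" "\<not> R w" for w
      using i2[OF that(1)] that sub by auto
    have n2: "R' w \<or> chain ?s (label ?s w) \<noteq> 0 \<and> N (chain ?s (label ?s w)) \<subseteq> N w"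
      if "w \<in> set (visited ?s)" for w
    proof (cases "w = v")
      case True
      then show ?thesis using v by (simp add: ch lv)
    next
      case False
      then have w: "w \<in> set (visited s)" using that by simp
      show ?thesis
      proof (cases "label s w = ?l")
        case True
        then show ?thesis using sub'[OF w] R'[OF w] v by (auto simp: ch keep[OF w])
      next
        case False
        then show ?thesis using i2[OF w] R'[OF w] by (simp add: ch keep[OF w])
      qed
    qed
    have n3: "N u \<subseteq> N w \<or> N w \<subseteq> N u"
      if uw: "u \<in> set (visited ?s)" "w \<in> set (visited ?s)" "label ?s u = label ?s w" "\<not> R' u" "\<not> R' w"
      for u w
    proof -
      consider "u = v" "w = v" | "u = v" "w \<in> set (visited s)" | "u \<in> set (visited s)" "w = v"
        | "u \<in> set (visited s)" "w \<in> set (visited s)" using uw by auto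
      then show ?thesis
      proof cases
        case 2
        then show ?thesis using sub'[of w] uw keep R' lv by metis
      next
        case 3
        then show ?thesis using sub'[of u] uw keep R' lv by metis
      next
        case 4
        then show ?thesis using i3 uw keep R' by metis
      qed simp
    qed
    have n4: "u \<in> N (stamp ?s u)" if "stamp ?s u \<noteq> 0" for u
      using i4 that unfolding st by (auto split: if_splits)
    show ?thesis
      unfolding sound_invariant_def Let_def R'_def[THEN fun_cong, symmetric]
      using n1 n2 n3 n4 by blast
  qed
qed

lemma sound_fold:
  assumes "good (fold (scan nb) vs scan_init)" "0 \<notin> set vs"
  shows "sound_invariant (fold (scan nb) vs scan_init)"
  using assms
proof (induction vs rule: rev_induct)
  case Nil
  then show ?case by (simp add: sound_invariant_def scan_init_def)
next
  case (snoc v vs)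
  then show ?case using sound_step good_scanD by auto
qed

text \<open>
  Vertices without neighbours are never scanned; they share the label \<open>0\<close>, and any two of them are
  twins.
\<close>

theorem good_imp_layered:
  assumes g: "good (fold (scan nb) vs scan_init)" and vs: "set vs = {v. nb v \<noteq> []}"
  shows "\<exists>c :: nat \<Rightarrow> nat. \<exists>K. layered UNIV N c K"
proof -
  let ?s = "fold (scan nb) vs scan_init"
  define R where "R = (\<lambda>v. N (rep N (label ?s) (visited ?s) v) = N v)"
  define c where "c = (\<lambda>v. if nb v = [] then 0 else label ?s v)"
  have "visited ?s = vs" by (simp add: visited_fold scan_init_def)
  moreover have "sound_invariant ?s" using sound_fold[OF g] vs nb_zero by simp
  ultimately have i: "\<forall>v\<in>set vs. label ?s v \<noteq> 0 \<and> (\<forall>u\<in>N v. label ?s u = label ?s v)"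
    "\<forall>u\<in>set vs. \<forall>v\<in>set vs. label ?s u = label ?s v \<longrightarrow> \<not> R u \<longrightarrow> \<not> R v \<longrightarrow> N u \<subseteq> N v \<or> N v \<subseteq> N u"
    and vis: "visited ?s = vs"
    unfolding sound_invariant_def Let_def R_def by auto
  have in_vs: "v \<in> set vs \<longleftrightarrow> nb v \<noteq> []" for v using vs by simp
  have "layered UNIV N c {v. R v}"
    unfolding layered_def
  proof (intro conjI ballI impI)
    fix v u assume "u \<in> N v"
    then have "nb u \<noteq> []" "nb v \<noteq> []" using nb_sym[of u v] by auto
    then show "c u = c v" using i(1) \<open>u \<in> N v\<close> in_vs by (simp add: c_def)
  next
    fix u v assume uv: "c u = c v" "u \<in> {v. R v}" "v \<in> {v. R v}"
    have "c w = 0 \<longleftrightarrow> nb w = []" for w using i(1) in_vs by (auto simp: c_def)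
    then have iso: "nb u = [] \<longleftrightarrow> nb v = []" using uv(1) by metis
    show "u \<in> N v \<or> N u = N v"
    proof (cases "nb u = [] \<or> nb v = []")
      case True
      then show ?thesis using iso by simp
    next
      case False
      then show ?thesis
        using rep_same_or_adjacent[of u vs v "label ?s"] uv in_vs vis by (simp add: c_def R_def)
    qed
  next
    fix u v assume "c u = c v" "u \<notin> {v. R v}" "v \<notin> {v. R v}"
    then show "N u \<subseteq> N v \<or> N v \<subseteq> N u"
      using i(2) in_vs by (cases "nb u = [] \<or> nb v = []") (auto simp: c_def)
  qed
  then show ?thesis by blast
qed

end

section \<open>Completeness of the scan\<close>

locale obstruction_free_lists = neighbour_lists nb + obstruction_free "set \<circ> nb" for nb
begin

text \<open>
  Exactly these vertices take the chain test.
\<close>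

definition below :: "scan_state \<Rightarrow> nat \<Rightarrow> bool" where
  "below s v \<longleftrightarrow> (\<exists>x\<in>set (visited s). conn x v \<and> x \<notin> N v \<and> deg x > deg v)"

text \<open>
  Labels are the components of the labelled vertices. Only neighbours of chain vertices carry stamps,
  and the stamps of the current chain vertices are intact: vertices of other components have no
  neighbours in common with them.
\<close>

definition complete_invariant :: "scan_state \<Rightarrow> bool" where
  "complete_invariant s \<longleftrightarrow>
     good s \<and>
     (\<forall>u. label s u \<noteq> 0 \<longleftrightarrow> u \<in> set (visited s) \<or> (\<exists>v\<in>set (visited s). u \<in> N v)) \<and>
     (\<forall>u. label s u \<noteq> 0 \<longrightarrow> label s u \<in> set (visited s)) \<and>
     (\<forall>u w. label s u \<noteq> 0 \<longrightarrow> label s w \<noteq> 0 \<longrightarrow> (label s u = label s w \<longleftrightarrow> conn u w)) \<and>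
     (\<forall>u. stamp s u \<noteq> 0 \<longrightarrow>
        stamp s u \<in> set (visited s) \<and> u \<in> N (stamp s u) \<and> chain s (label s (stamp s u)) \<noteq> 0) \<and>
     (\<forall>l. chain s l \<noteq> 0 \<longrightarrow>
        chain s l \<in> set (visited s) \<and> label s (chain s l) = l \<and> below s (chain s l) \<and>
        (\<forall>u\<in>N (chain s l). stamp s u = chain s l))"

lemma conn_common: "u \<in> N a \<Longrightarrow> u \<in> N b \<Longrightarrow> conn a b"
  unfolding conn_def by blast

lemma conn_adj: "u \<in> N a \<Longrightarrow> conn u a"
  unfolding conn_def by blast

lemma larger_degree_superset:
  assumes "conn u v" "u \<notin> N v" "deg v \<le> deg u"
  shows "N v \<subseteq> N u"
  using comparable[OF assms(1,2)] subset_degree_eq[of u v] assms(3) by auto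

text \<open>
  Degrees decrease along the scan. A nonneighbour of \<open>v\<close> in its component that was scanned before thus
  has a neighbourhood that contains the one of \<open>v\<close>. This makes the representative of equal degree a
  twin. In the chain test the previous chain vertex is a nonneighbour by \<open>below_nonadjacent\<close>.
\<close>

lemma complete_step:
  assumes inv: "complete_invariant s" and v: "v \<notin> set (visited s)" "nb v \<noteq> []"
    and sorted: "\<And>w. w \<in> set (visited s) \<Longrightarrow> deg v \<le> deg w"
  shows "complete_invariant (scan nb v s)"
proof -
  let ?s = "scan nb v s"
  let ?l = "start_label nb (label s) v"
  define x where "x = rep N (label ?s) (visited ?s) v"
  have i0: "good s" using inv by (simp add: complete_invariant_def)
  have i1: "label s u \<noteq> 0 \<longleftrightarrow> u \<in> set (visited s) \<or> (\<exists>v\<in>set (visited s). u \<in> N v)" for u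
    using inv unfolding complete_invariant_def by blast
  have i2: "label s u \<noteq> 0 \<Longrightarrow> label s u \<in> set (visited s)" for u
    using inv unfolding complete_invariant_def by blast
  have i3: "label s u \<noteq> 0 \<Longrightarrow> label s w \<noteq> 0 \<Longrightarrow> label s u = label s w \<longleftrightarrow> conn u w" for u w
    using inv unfolding complete_invariant_def by blast
  have i4: "stamp s u \<in> set (visited s)" "u \<in> N (stamp s u)"
    "chain s (label s (stamp s u)) \<noteq> 0" if "stamp s u \<noteq> 0" for u
    using inv that unfolding complete_invariant_def by blast+
  have i5: "chain s l \<in> set (visited s)" "label s (chain s l) = l" "below s (chain s l)"
    "u \<in> N (chain s l) \<Longrightarrow> stamp s u = chain s l" if "chain s l \<noteq> 0" for l u
    using inv that unfolding complete_invariant_def by blast+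
  have v0: "v \<noteq> 0" using v nb_zero by metis
  have h: "hd (nb v) \<in> N v" using v by simp
  have l0: "?l \<noteq> 0" using start_label_nonzero[OF v0] .
  have label_l: "label s w = ?l \<longleftrightarrow> conn w v" if w: "label s w \<noteq> 0" for w
  proof (cases "label s v \<noteq> 0")
    case True
    then show ?thesis using i3[OF w] by (simp add: start_label_def)
  next
    case lv: False
    show ?thesis
    proof (cases "label s (hd (nb v)) \<noteq> 0")
      case True
      have "conn w (hd (nb v)) \<longleftrightarrow> conn w v"
        using h conn_step[of w v "hd (nb v)"] conn_step[of w "hd (nb v)" v] sym by blast
      then show ?thesis using lv True i3[OF w] by (simp add: start_label_def)
    next
      case False
      then have "?l = v" using lv by (simp add: start_label_def)
      moreover have "label s w \<noteq> v" using i2[OF w] v by metis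
      \<comment> \<open>a scanned vertex of the component would contain the neighbourhood of \<open>v\<close> and have labelled it\<close>
      moreover have "\<not> conn w v"
      proof
        assume wv: "conn w v"
        obtain z where z: "z \<in> set (visited s)" "conn z v"
          using i1[of w] w wv conn_trans conn_adj conn_sym by meson
        have "z \<notin> N v" using i1[of v] lv z(1) sym by blast
        then have "N v \<subseteq> N z" using larger_degree_superset z sorted by blast
        then show False using h i1[of "hd (nb v)"] False z(1) by blast
      qed
      ultimately show ?thesis by simp
    qed
  qed
  have lab_v: "label ?s v = ?l" by (rule label_new)
  have lab: "label ?s u = (if label s u = 0 \<and> (u = v \<or> u \<in> N v) then ?l else label s u)" for u
    by (auto simp: label_scan spread_label_def start_label_def)
  have n1: "label ?s u \<noteq> 0 \<longleftrightarrow> u \<in> set (visited ?s) \<or> (\<exists>v\<in>set (visited ?s). u \<in> N v)" for u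
    using i1[of u] l0 unfolding lab by auto
  have n2: "label ?s u \<in> set (visited ?s)" if "label ?s u \<noteq> 0" for u
    using that i2[of u] i2[of v] i2[of "hd (nb v)"] unfolding lab
    by (auto simp: start_label_def split: if_splits)
  have label_l': "label ?s w = ?l \<longleftrightarrow> conn w v" if "label ?s w \<noteq> 0" for w
  proof (cases "label s w = 0")
    case True
    then have "w = v \<or> w \<in> N v" using that unfolding lab by (auto split: if_splits)
    then show ?thesis using True conn_adj by (auto simp: lab conn_def)
  next
    case False
    then show ?thesis using label_l by (simp add: lab)
  qed
  have n3: "label ?s u = label ?s w \<longleftrightarrow> conn u w" if "label ?s u \<noteq> 0" "label ?s w \<noteq> 0" for u w
  proof (cases "label ?s u = ?l \<or> label ?s w = ?l")
    case True
    then show ?thesis using label_l'[OF that(1)] label_l'[OF that(2)] conn_sym conn_trans by metis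
  next
    case False
    then have "label ?s u = label s u" "label ?s w = label s w" unfolding lab by (auto split: if_splits)
    then show ?thesis using i3[of u w] that by simp
  qed
  have ok: "\<forall>u\<in>N v. label s u = 0 \<or> label s u = ?l" using label_l conn_adj by blast
  have x: "x \<in> set (visited ?s)" "label ?s x = ?l" "x \<notin> N v"
    using rep_in[of v "visited ?s" "label ?s"] lab_v unfolding x_def by auto
  have xv: "conn x v" using label_l'[of x] x l0 by simp
  have dx: "deg v \<le> deg x" using x(1) sorted by auto
  have x_eq: "x = rep N (spread_label nb (label s) v) (visited s @ [v]) v"
    by (simp add: x_def label_scan)
  have vis_lab: "label ?s w = label s w" if "w \<in> set (visited s)" for w
    using i1[of w] that by (simp add: lab)
  have below_mono: "below ?s w" if "below s w" for w using that by (auto simp: below_def)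
  show ?thesis
  proof (cases "deg x = deg v")
    case True
    have "N x \<subseteq> N v" using larger_degree_superset[OF xv x(3) dx] subset_degree_eq[of v x] True by simp
    then have "good ?s" using i0 ok True by (simp add: scan_def Let_def flip: x_eq)
    moreover have "stamp ?s = stamp s" "chain ?s = chain s"
      using True by (simp_all add: scan_def Let_def flip: x_eq)
    ultimately show ?thesis
      unfolding complete_invariant_def using n1 n2 n3 i4 i5 vis_lab below_mono by auto
  next
    case False
    have st: "stamp ?s = (\<lambda>u. if u \<in> set (nb v) then v else stamp s u)"
      and ch: "chain ?s = (chain s)(?l := v)"
      using False by (simp_all add: scan_def Let_def flip: x_eq)
    have Nx: "\<not> N x \<subseteq> N v" using subset_degree_eq[of x v] dx False by (metis deg_card)
    have lab_conn: "label s t = ?l" if "t \<in> set (visited s)" "conn t v" for t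
      using label_l[of t] i1[of t] that by simp
    have "\<forall>u\<in>N v. stamp s u = chain s ?l"
    proof
      fix u assume u: "u \<in> N v"
      show "stamp s u = chain s ?l"
      proof (cases "chain s ?l = 0")
        case True
        have "stamp s u = 0"
        proof (rule ccontr)
          assume nz: "stamp s u \<noteq> 0"
          then have "label s (stamp s u) = ?l" using lab_conn i4 u conn_common by blast
          then show False using i4(3)[OF nz] True by simp
        qed
        then show ?thesis using True by simp
      next
        case False
        let ?t = "chain s ?l"
        have t: "?t \<in> set (visited s)" "label s ?t = ?l" "below s ?t" using i5 False by blast+
        then have tv: "conn ?t v" using label_l[of ?t] l0 by metis
        obtain y where y: "conn y ?t" "y \<notin> N ?t" "deg ?t < deg y" using t by (auto simp: below_def)
        then have "\<not> N y \<subseteq> N ?t" using subset_degree_eq[of y ?t] by (metis deg_card less_imp_le nat_neq_iff)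
        then have "v \<notin> N ?t" using below_nonadjacent[OF xv x(3) Nx] y by blast
        then have "N v \<subseteq> N ?t" using larger_degree_superset[OF tv] sorted t(1) sym by blast
        then show ?thesis using i5(4)[OF False] u by blast
      qed
    qed
    then have "good ?s" using i0 ok False by (simp add: scan_def Let_def flip: x_eq)
    moreover have "stamp ?s u \<in> set (visited ?s) \<and> u \<in> N (stamp ?s u) \<and>
        chain ?s (label ?s (stamp ?s u)) \<noteq> 0" if "stamp ?s u \<noteq> 0" for u
      using i4[of u] that v0 lab_v vis_lab unfolding st ch by (auto split: if_splits)
    moreover have "chain ?s l \<in> set (visited ?s) \<and> label ?s (chain ?s l) = l \<and>
        below ?s (chain ?s l) \<and> (\<forall>u\<in>N (chain ?s l). stamp ?s u = chain ?s l)"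
      if "chain ?s l \<noteq> 0" for l
    proof (cases "l = ?l")
      case True
      have "below ?s v" unfolding below_def using x xv dx False by (metis le_neq_implies_less)
      then show ?thesis using True lab_v by (simp add: ch st)
    next
      case F: False
      then have c: "chain s l \<noteq> 0" using that by (simp add: ch)
      note c5 = i5[OF c]
      have "u \<notin> N v" if "u \<in> N (chain s l)" for u
        using lab_conn[OF c5(1)] conn_common[OF that] c5(2) F by metis
      then show ?thesis using c5 vis_lab[OF c5(1)] below_mono F by (auto simp: ch st)
    qed
    ultimately show ?thesis unfolding complete_invariant_def using n1 n2 n3 by blast
  qed
qed

theorem sorted_imp_good:
  assumes "sorted_wrt (\<lambda>a b. deg b \<le> deg a) vs" "distinct vs" "\<forall>v\<in>set vs. nb v \<noteq> []"
  shows "good (fold (scan nb) vs scan_init)"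
proof -
  have "complete_invariant (fold (scan nb) vs scan_init)" using assms
  proof (induction vs rule: rev_induct)
    case Nil
    then show ?case by (simp add: complete_invariant_def scan_init_def)
  next
    case (snoc v vs)
    then have "complete_invariant (scan nb v (fold (scan nb) vs scan_init))"
      using nb_zero by (intro complete_step) (auto simp: visited_fold scan_init_def sorted_wrt_append)
    then show ?case by simp
  qed
  then show ?thesis by (simp add: complete_invariant_def)
qed

end

section \<open>A structured language and its compiler\<close>

text \<open>
  The variables are kept in registers; \<open>Acc\<close> is register \<open>0\<close> and holds the verdict.
\<close>

datatype var = Acc | Ver | Lab | Nb | Cur | Cnt | Flag | Dg

text \<open>
  \<open>ALabel\<close>, \<open>AStamp\<close> and \<open>AChain\<close> hold the corresponding functions of the scan. \<open>AMark\<close> marks the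
  neighbours of the vertex that is being scanned by its number. \<open>ANext\<close> and \<open>ATail\<close> make each label
  class a linked list in scanning order, and \<open>AHead\<close> and \<open>ALink\<close> form one linked list of vertices
  for each degree.
\<close>

datatype arr = AHead | ALink | ALabel | AMark | ANext | ATail | AChain | AStamp

text \<open>
  \<open>OEq\<close> computes a truth value, and \<open>OCheck\<close> clears the verdict if its argument is \<open>0\<close>. The other
  operations read the adjacency lists and the arrays by vertex numbers.
\<close>

datatype op =
    OSize var
  | OConst var nat
  | OMov var var
  | ODec var
  | OEq var var var
  | OCheck var
  | ODegree var var
  | ONeighbor var var var
  | OGet var arr var
  | OPut arr var var

datatype com =
    Ops "op list"
  | Seq com com  (infixr ";;" 60)
  | IfNZ var com com
  | WhileNZ var com

fun reg :: "var \<Rightarrow> nat" where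
  "reg Acc = 0" | "reg Ver = 1" | "reg Lab = 2" | "reg Nb = 3"
| "reg Cur = 4" | "reg Cnt = 5" | "reg Flag = 6" | "reg Dg = 7"

fun arr_index :: "arr \<Rightarrow> nat" where
  "arr_index AHead = 0" | "arr_index ALink = 1" | "arr_index ALabel = 2" | "arr_index AMark = 3"
| "arr_index ANext = 4" | "arr_index ATail = 5" | "arr_index AChain = 6" | "arr_index AStamp = 7"

abbreviation base_reg :: "arr \<Rightarrow> nat" where "base_reg a \<equiv> 8 + arr_index a"
abbreviation one_reg :: nat where "one_reg \<equiv> 16"
abbreviation tmp :: nat where "tmp \<equiv> 17"
abbreviation tmp' :: nat where "tmp' \<equiv> 18"

text \<open>
  In the code for \<open>OEq\<close> the sum of the two truncated differences is the distance of the arguments. An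
  adjacency list for vertex number \<open>v\<close> starts at the address in cell \<open>v\<close>, because input vertices are
  numbered from \<open>0\<close> and cell \<open>0\<close> holds their number.
\<close>

fun op_code :: "op \<Rightarrow> instr list" where
  "op_code (OSize x) = [Const tmp 0, Load (reg x) tmp]"
| "op_code (OConst x k) = [Const (reg x) k]"
| "op_code (OMov x y) = [Copy (reg x) (reg y)]"
| "op_code (ODec x) = [Sub (reg x) (reg x) one_reg]"
| "op_code (OEq x y z) = [Sub tmp (reg y) (reg z), Sub tmp' (reg z) (reg y), Add tmp tmp tmp',
     Sub (reg x) one_reg tmp]"
| "op_code (OCheck x) = [Sub tmp one_reg (reg x), Sub (reg Acc) (reg Acc) tmp]"
| "op_code (ODegree x y) = [Load tmp (reg y), Add tmp' (reg y) one_reg, Load tmp' tmp',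
     Sub (reg x) tmp' tmp]"
| "op_code (ONeighbor x y k) = [Load tmp (reg y), Add tmp tmp (reg k), Load tmp tmp,
     Add (reg x) tmp one_reg]"
| "op_code (OGet x a y) = [Add tmp (base_reg a) (reg y), Load (reg x) tmp]"
| "op_code (OPut a y x) = [Add tmp (base_reg a) (reg y), Store tmp (reg x)]"

fun code :: "nat \<Rightarrow> com \<Rightarrow> instr list" where
  "code off (Ops xs) = concat (map op_code xs)"
| "code off (Seq c d) = (let p = code off c in p @ code (off + length p) d)"
| "code off (IfNZ x c d) =
     (let p = code (Suc off) c; mid = off + length p + 2; q = code mid d
      in JumpZero (reg x) mid # p @ Jump (mid + length q) # q)"
| "code off (WhileNZ x c) =
     (let p = code (Suc off) c
      in JumpZero (reg x) (off + length p + 2) # p @ [Jump off])"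

lemma reg_inj [simp]: "reg x = reg y \<longleftrightarrow> x = y"
  by (cases x; cases y) auto

lemma arr_index_inj [simp]: "arr_index a = arr_index b \<longleftrightarrow> a = b"
  by (cases a; cases b) auto

lemma reg_less: "reg x < 8" by (cases x) auto

lemma arr_index_less: "arr_index a < 8" by (cases a) auto

lemma reg_neq [simp]:
  "reg x \<noteq> base_reg a" "base_reg a \<noteq> reg x" "reg x \<noteq> one_reg" "one_reg \<noteq> reg x" "reg x \<noteq> tmp" "tmp \<noteq> reg x"
  "reg x \<noteq> tmp'" "tmp' \<noteq> reg x" "base_reg a \<noteq> one_reg" "one_reg \<noteq> base_reg a" "base_reg a \<noteq> tmp"
  "tmp \<noteq> base_reg a" "base_reg a \<noteq> tmp'" "tmp' \<noteq> base_reg a"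
  using reg_less[of x] arr_index_less[of a] by linarith+

text \<open>
  Meaningful for programs without loops only; the running times of loops come from \<open>runs_while\<close>.
\<close>

primrec cost :: "com \<Rightarrow> nat" where
  "cost (Ops xs) = 4 * length xs"
| "cost (c ;; d) = cost c + cost d"
| "cost (IfNZ x c d) = cost c + cost d + 2"
| "cost (WhileNZ x c) = 0"

section \<open>Executions of the machine\<close>

definition placed :: "instr list \<Rightarrow> nat \<Rightarrow> instr list \<Rightarrow> bool" where
  "placed P off p \<longleftrightarrow> (\<exists>ys zs. P = ys @ p @ zs \<and> length ys = off)"

lemma placed_append:
  assumes "placed P off (p @ q)"
  shows "placed P off p" "placed P (off + length p) q"
proof -
  obtain ys zs where *: "P = ys @ (p @ q) @ zs" "length ys = off"
    using assms unfolding placed_def by blast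
  have "P = ys @ p @ (q @ zs)" using *(1) by simp
  then show "placed P off p" using *(2) unfolding placed_def by blast
  have "P = (ys @ p) @ q @ zs" "length (ys @ p) = off + length p" using * by simp_all
  then show "placed P (off + length p) q" unfolding placed_def by blast
qed

lemma placed_Cons:
  assumes "placed P off (i # p)"
  shows "placed P (Suc off) p" "off < length P" "P ! off = i"
proof -
  show "placed P (Suc off) p" using placed_append(2)[of P off "[i]" p] assms by simp
  obtain ys zs where "P = ys @ (i # p) @ zs" "length ys = off"
    using assms unfolding placed_def by blast
  then show "off < length P" "P ! off = i" by auto
qed

text \<open>
  An execution of exactly \<open>t\<close> steps that respects the word size throughout. The recursion makes
  executions composable.
\<close>

primrec reaches :: "nat \<Rightarrow> instr list \<Rightarrow> nat \<Rightarrow> config \<Rightarrow> config \<Rightarrow> bool" where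
  "reaches W P 0 s s' \<longleftrightarrow> s' = s \<and> values_below W s"
| "reaches W P (Suc t) s s' \<longleftrightarrow> values_below W s \<and> reaches W P t (step P s) s'"

lemma reaches_run:
  "reaches W P t s s' \<longleftrightarrow> s' = run P t s \<and> (\<forall>t'\<le>t. values_below W (run P t' s))"
proof (induction t arbitrary: s)
  case 0
  then show ?case by (simp add: run_def)
next
  case (Suc t)
  have "(\<forall>t'\<le>Suc t. values_below W (run P t' s)) \<longleftrightarrow>
      values_below W s \<and> (\<forall>t'\<le>t. values_below W (run P t' (step P s)))"
    unfolding run_def less_Suc_eq_le[symmetric] All_less_Suc2[of "Suc t"]
    by (simp add: funpow_swap1)
  then show ?case using Suc by (auto simp: run_def funpow_swap1)
qed

lemma reaches_trans:
  "reaches W P t s s' \<Longrightarrow> reaches W P u s' s'' \<Longrightarrow> reaches W P (t + u) s s''"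
  by (induction t arbitrary: s) auto

lemma step_placed: "placed P (pc s) (i # p) \<Longrightarrow> step P s = exec_instr i s"
  using placed_Cons[of P "pc s" i p] by (simp add: step_def halted_def)

fun straight :: "instr \<Rightarrow> bool" where
  "straight (Jump l) = False"
| "straight (JumpZero x l) = False"
| "straight _ = True"

lemma pc_straight: "straight i \<Longrightarrow> pc (exec_instr i s) = Suc (pc s)"
  by (cases i) (auto simp: set_reg_def)

primrec all_below :: "nat \<Rightarrow> instr list \<Rightarrow> config \<Rightarrow> bool" where
  "all_below W [] s \<longleftrightarrow> values_below W s"
| "all_below W (i # p) s \<longleftrightarrow> values_below W s \<and> all_below W p (exec_instr i s)"

lemma reaches_straight:
  assumes "placed P (pc s) p" "list_all straight p" "all_below W p s"
  shows "reaches W P (length p) s (fold exec_instr p s)"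
    and "pc (fold exec_instr p s) = pc s + length p"
  using assms
proof (induction p arbitrary: s)
  case Nil
  { case 1 then show ?case by simp }
  { case 2 then show ?case by simp }
next
  case (Cons i p)
  have pl: "placed P (pc (exec_instr i s)) p" if "placed P (pc s) (i # p)" "straight i" for s
    using placed_Cons(1)[OF that(1)] pc_straight[OF that(2)] by simp
  { case (1 s)
    then have "straight i" by simp
    show ?case
      using 1 Cons.IH(1)[OF pl[OF 1(1) \<open>straight i\<close>]] step_placed[OF 1(1)] by simp }
  { case (2 s)
    then have "straight i" by simp
    show ?case
      using 2 Cons.IH(2)[OF pl[OF 2(1) \<open>straight i\<close>]] pc_straight[OF \<open>straight i\<close>, of s] by simp }
qed

lemma regs_set_reg [simp]: "regs (set_reg a x s) = (regs s)(a := x)"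
  by (simp add: set_reg_def)

lemma mem_set_reg [simp]: "mem (set_reg a x s) = mem s"
  by (simp add: set_reg_def)

lemma values_below_set_reg [simp]:
  "values_below W s \<Longrightarrow> x < W \<Longrightarrow> values_below W (set_reg a x s)"
  by (simp add: values_below_def)

lemma values_below_store [simp]:
  "values_below W s \<Longrightarrow> v < W \<Longrightarrow> mem s = m \<Longrightarrow> values_below W (s\<lparr>pc := l, mem := m(a := v)\<rparr>)"
  by (simp add: values_below_def)

section \<open>Representation of a graph in memory\<close>

type_synonym env = "var \<Rightarrow> nat"
type_synonym arrays = "arr \<Rightarrow> nat \<Rightarrow> nat"

text \<open>
  The word size exceeds every address of the encoded graph and of the eight arrays behind it.
\<close>

locale ram_graph =
  fixes adj :: "nat list list" and W :: nat
  assumes entries: "v < length adj \<Longrightarrow> u \<in> set (adj ! v) \<Longrightarrow> u < length adj"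
    and word_size: "2 * length adj + length (concat adj) + 8 * (length adj + 1) + 2 < W"
begin

abbreviation n :: nat where "n \<equiv> length adj"

definition heap :: nat where "heap = n + 2 + length (concat adj)"

definition base :: "arr \<Rightarrow> nat" where "base a = heap + arr_index a * (n + 1)"

text \<open>
  The adjacency lists for vertex numbers, which are shifted by one.
\<close>

definition nb :: "nat \<Rightarrow> nat list" where
  "nb v = (if 1 \<le> v \<and> v \<le> n then map Suc (adj ! (v - 1)) else [])"

text \<open>
  The arrays have one cell for each number from \<open>0\<close> to \<open>n\<close>, where \<open>0\<close> is a dummy vertex.
\<close>

definition represents :: "env \<Rightarrow> arrays \<Rightarrow> config \<Rightarrow> bool" where
  "represents e F s \<longleftrightarrow>
     values_below W s \<and> (\<forall>x. regs s (reg x) = e x) \<and> (\<forall>a. regs s (base_reg a) = base a) \<and>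
     regs s one_reg = 1 \<and> (\<forall>i<heap. mem s i = encode_graph adj ! i) \<and>
     (\<forall>a i. i \<le> n \<longrightarrow> mem s (base a + i) = F a i)"

lemma length_encode: "length (encode_graph adj) = heap"
  by (simp add: encode_graph_def heap_def)

lemma encode_nth_start: "v \<le> n \<Longrightarrow> encode_graph adj ! Suc v = list_start adj v"
  by (simp add: encode_graph_def nth_append del: upt_Suc)

lemma encode_nth_entry:
  assumes "v < n" "k < length (adj ! v)"
  shows "list_start adj v + k < heap" "encode_graph adj ! (list_start adj v + k) = adj ! v ! k"
proof -
  let ?a = "concat (take v adj)" and ?b = "concat (drop (Suc v) adj)"
  have c: "concat adj = ?a @ adj ! v @ ?b"
    using id_take_nth_drop[OF assms(1)] by (metis concat.simps(2) concat_append)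
  show "list_start adj v + k < heap"
    using assms(2) by (simp add: heap_def list_start_def c)
  have "encode_graph adj = (n # map (list_start adj) [0..<n + 1]) @ concat adj"
    by (simp add: encode_graph_def)
  moreover have "list_start adj v + k =
      length (n # map (list_start adj) [0..<n + 1]) + (length ?a + k)"
    by (simp add: list_start_def)
  ultimately have "encode_graph adj ! (list_start adj v + k) = concat adj ! (length ?a + k)"
    by (simp only: nth_append_length_plus)
  also have "\<dots> = adj ! v ! k"
    using assms(2) by (simp add: c nth_append)
  finally show "encode_graph adj ! (list_start adj v + k) = adj ! v ! k" .
qed

lemma list_start_Suc: "v < n \<Longrightarrow> list_start adj (Suc v) = list_start adj v + length (adj ! v)"
  by (simp add: list_start_def take_Suc_conv_app_nth)

lemma base_bound: "i \<le> n \<Longrightarrow> base a + i < W"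
proof -
  assume "i \<le> n"
  have "arr_index a * (n + 1) \<le> 7 * (n + 1)" using arr_index_less[of a] by (intro mult_le_mono1) simp
  then show ?thesis using \<open>i \<le> n\<close> word_size by (simp add: base_def heap_def)
qed

text \<open>
  Distinct array cells have distinct addresses, so a write to one array leaves the others intact.
\<close>

lemma base_inj:
  assumes "i \<le> n" "j \<le> n" "base a + i = base b + j"
  shows "a = b \<and> i = j"
proof -
  have "arr_index a * (n + 1) + i = arr_index b * (n + 1) + j" using assms by (simp add: base_def)
  moreover have "(k * m + l) div m = k" "(k * m + l) mod m = l"
    if "l < m" for k l m :: nat using that by simp_all
  ultimately have "arr_index a = arr_index b" "i = j" using assms by (metis less_Suc_eq_le Suc_eq_plus1)+
  then show ?thesis by simp
qed

lemma heap_le_base: "heap \<le> base a + i"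
  by (simp add: base_def)

fun op_ok :: "op \<Rightarrow> env \<Rightarrow> bool" where
  "op_ok (OConst x k) e \<longleftrightarrow> k \<le> 1"
| "op_ok (ODegree x y) e \<longleftrightarrow> 1 \<le> e y \<and> e y \<le> n"
| "op_ok (ONeighbor x y k) e \<longleftrightarrow> 1 \<le> e y \<and> e y \<le> n \<and> e k < length (nb (e y))"
| "op_ok (OGet x a y) e \<longleftrightarrow> e y \<le> n"
| "op_ok (OPut a y x) e \<longleftrightarrow> e y \<le> n"
| "op_ok _ e \<longleftrightarrow> True"

fun exec_op :: "op \<Rightarrow> env \<times> arrays \<Rightarrow> env \<times> arrays" where
  "exec_op (OSize x) (e, F) = (e(x := n), F)"
| "exec_op (OConst x k) (e, F) = (e(x := k), F)"
| "exec_op (OMov x y) (e, F) = (e(x := e y), F)"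
| "exec_op (ODec x) (e, F) = (e(x := e x - 1), F)"
| "exec_op (OEq x y z) (e, F) = (e(x := of_bool (e y = e z)), F)"
| "exec_op (OCheck x) (e, F) = (e(Acc := e Acc - (1 - e x)), F)"
| "exec_op (ODegree x y) (e, F) = (e(x := length (nb (e y))), F)"
| "exec_op (ONeighbor x y k) (e, F) = (e(x := nb (e y) ! e k), F)"
| "exec_op (OGet x a y) (e, F) = (e(x := F a (e y)), F)"
| "exec_op (OPut a y x) (e, F) = (e, F(a := (F a)(e y := e x)))"

lemma represents_tmp [simp]:
  assumes "represents e F s" "v < W" "r = tmp \<or> r = tmp'"
  shows "represents e F (set_reg r v s)"
  using assms by (auto simp: represents_def)

lemma represents_reg [simp]:
  assumes "represents e F s" "v < W"
  shows "represents (e(x := v)) F (set_reg (reg x) v s)"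
  using assms by (auto simp: represents_def)

lemma represents_store:
  assumes r: "represents e F s" and "i \<le> n" "v < W"
  shows "represents e (F(a := (F a)(i := v))) (s\<lparr>pc := l, mem := (mem s)(base a + i := v)\<rparr>)"
proof -
  have "mem s' (base b + j) = (F(a := (F a)(i := v))) b j"
    if "s' = s\<lparr>pc := l, mem := (mem s)(base a + i := v)\<rparr>" "j \<le> n" for s' b j
    using that r base_inj[of j i b a] \<open>i \<le> n\<close> by (auto simp: represents_def)
  moreover have "k \<noteq> base a + i" if "k < heap" for k using that heap_le_base[of a i] by simp
  ultimately show ?thesis using assms by (auto simp: represents_def values_below_def)
qed

text \<open>
  Addresses stay inside the code of single operations, so this lemma settles the word size: the values of variables are
  vertices, truth values or degrees, and the largest intermediate values are addresses of cells.
\<close>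

lemma op_correct:
  assumes r: "represents e F s" and ok: "op_ok p e"
  shows "all_below W (op_code p) s"
    and "case exec_op p (e, F) of (e', F') \<Rightarrow> represents e' F' (fold exec_instr (op_code p) s)"
proof -
  have vb: "values_below W s" and R: "\<And>x. regs s (reg x) = e x"
    and B: "\<And>a. regs s (base_reg a) = base a" and one: "regs s one_reg = Suc 0"
    and I: "\<And>i. i < heap \<Longrightarrow> mem s i = encode_graph adj ! i"
    and A: "\<And>a i. i \<le> n \<Longrightarrow> mem s (base a + i) = F a i"
    using r by (auto simp: represents_def)
  have eW: "e x < W" for x using vb R by (metis values_below_def)
  have mW: "mem s i < W" for i using vb by (simp add: values_below_def)
  have nW: "n < W" "Suc n < W" "Suc 0 < W" "heap < W" "0 < W" using word_size by (auto simp: heap_def)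
  have size: "mem s 0 = n" using I[of 0] by (simp add: heap_def encode_graph_def)
  have start: "mem s v = list_start adj (v - 1)" if "1 \<le> v" "v \<le> Suc n" for v
    using I[of v] encode_nth_start[of "v - 1"] that by (simp add: heap_def)
  have deg: "mem s (Suc v) - mem s v = length (nb v)" if "1 \<le> v" "v \<le> n" for v
    using start[of v] start[of "Suc v"] list_start_Suc[of "v - 1"] that by (simp add: nb_def)
  have nbr: "mem s v + k < heap" "Suc (mem s (mem s v + k)) = nb v ! k"
    if "1 \<le> v" "v \<le> n" "k < length (nb v)" for v k
    using encode_nth_entry[of "v - 1" k] I start[of v] that by (auto simp: nb_def)
  have nbr_le: "nb v ! k \<le> n" if "1 \<le> v" "v \<le> n" "k < length (nb v)" for v k
    using entries[of "v - 1" "adj ! (v - 1) ! k"] that by (auto simp: nb_def Suc_le_eq)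
  have eq: "Suc 0 - (a - b + (b - a)) = of_bool (a = b)" for a b :: nat by auto
  have sub: "a - b + (b - a) < W" if "a < W" "b < W" for a b :: nat using that by auto
  have subW: "a - b < W" if "a < W" for a b :: nat using that by simp
  have small: "k < W" if "k \<le> Suc 0" for k using that nW by simp
  have FW: "F a i < W" if "i \<le> n" for a i using A[OF that] mW by metis
  have acc: "regs s 0 = e Acc" using R[of Acc] by simp
  note facts = small FW acc represents_reg[where x = Acc, simplified] vb R B one eW mW nW size A r eq sub subW base_bound
  have lenW: "length (nb v) < W" if "1 \<le> v" "v \<le> n" for v
    using deg[OF that] mW subW by metis
  show "all_below W (op_code p) s"
  proof (cases p)
    case (ODegree x y)
    then have "Suc (e y) < W" using ok nW by simp
    then show ?thesis using ODegree ok deg[of "e y"] lenW by (simp add: facts)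
  next
    case (ONeighbor x y k)
    then have "mem s (e y) + e k < W" "Suc (mem s (mem s (e y) + e k)) < W"
      using ok nbr[of "e y" "e k"] nbr_le[of "e y" "e k"] nW by auto
    then show ?thesis using ok ONeighbor by (simp add: facts)
  qed (use ok in \<open>auto simp: facts\<close>)
  show "case exec_op p (e, F) of (e', F') \<Rightarrow> represents e' F' (fold exec_instr (op_code p) s)"
  proof (cases p)
    case (ODegree x y)
    then have "Suc (e y) < W" using ok nW by simp
    then show ?thesis using ODegree ok deg[of "e y"] lenW by (simp add: facts)
  next
    case (ONeighbor x y k)
    then have "mem s (e y) + e k < W" "Suc (mem s (mem s (e y) + e k)) = nb (e y) ! e k"
       "nb (e y) ! e k < W"
      using ok nbr[of "e y" "e k"] nbr_le[of "e y" "e k"] nW by auto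
    then show ?thesis using ok ONeighbor by (simp add: facts)
  next
    case (OPut a y x)
    then have "represents e F (set_reg tmp (base a + e y) s)" "e y \<le> n"
      using ok by (simp_all add: facts)
    from represents_store[OF this, of "e x" a] show ?thesis using OPut by (simp add: facts)
  qed (use ok in \<open>auto simp: facts\<close>)
qed

section \<open>Program logic\<close>

text \<open>
  Started with variables \<open>e\<close> and arrays \<open>F\<close>, the code of \<open>c\<close> reaches its end within \<open>T\<close> steps in a state
  that satisfies \<open>Q\<close>. Since \<open>runs d U Q\<close> is itself a property of states, it can serve as the
  postcondition in a sequential composition.
\<close>

definition runs :: "com \<Rightarrow> nat \<Rightarrow> (env \<Rightarrow> arrays \<Rightarrow> bool) \<Rightarrow> env \<Rightarrow> arrays \<Rightarrow> bool" where
  "runs c T Q e F \<longleftrightarrow>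
     (\<forall>P s. placed P (pc s) (code (pc s) c) \<longrightarrow> represents e F s \<longrightarrow>
        (\<exists>t\<le>T. \<exists>s' e' F'. reaches W P t s s' \<and> pc s' = pc s + length (code (pc s) c) \<and>
           represents e' F' s' \<and> Q e' F'))"

lemma runsI:
  assumes "\<And>P s. placed P (pc s) (code (pc s) c) \<Longrightarrow> represents e F s \<Longrightarrow>
    \<exists>t\<le>T. \<exists>s' e' F'. reaches W P t s s' \<and> pc s' = pc s + length (code (pc s) c) \<and>
           represents e' F' s' \<and> Q e' F'"
  shows "runs c T Q e F"
  using assms unfolding runs_def by blast

lemma runsE:
  assumes "runs c T Q e F" "placed P off (code off c)" "represents e F s" "pc s = off"
  obtains t s' e' F' where "t \<le> T" "reaches W P t s s'"
    "pc s' = off + length (code off c)" "represents e' F' s'" "Q e' F'"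
  using assms unfolding runs_def by blast

lemma runs_mono:
  assumes "runs c T Q e F" "T \<le> T'" "\<And>e' F'. Q e' F' \<Longrightarrow> Q' e' F'"
  shows "runs c T' Q' e F"
proof (rule runsI)
  fix P s assume "placed P (pc s) (code (pc s) c)" "represents e F s"
  then obtain t s' e' F' where "t \<le> T" "reaches W P t s s'"
    "pc s' = pc s + length (code (pc s) c)" "represents e' F' s'" "Q e' F'"
    using runsE[OF assms(1) _ _ refl] by metis
  then show "\<exists>t\<le>T'. \<exists>s' e' F'. reaches W P t s s' \<and> pc s' = pc s + length (code (pc s) c) \<and>
           represents e' F' s' \<and> Q' e' F'"
    using assms(2,3) le_trans by metis
qed

primrec wp_ops :: "op list \<Rightarrow> (env \<Rightarrow> arrays \<Rightarrow> bool) \<Rightarrow> env \<Rightarrow> arrays \<Rightarrow> bool" where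
  "wp_ops [] Q e F \<longleftrightarrow> Q e F"
| "wp_ops (p # ps) Q e F \<longleftrightarrow> op_ok p e \<and> wp_ops ps Q (fst (exec_op p (e, F))) (snd (exec_op p (e, F)))"

lemma straight_op: "list_all straight (op_code p)"
  by (cases p) auto

lemma length_op: "length (op_code p) \<le> 4"
  by (cases p) auto

lemma runs_Ops:
  assumes "wp_ops xs Q e F"
  shows "runs (Ops xs) (4 * length xs) Q e F"
  using assms
proof (induction xs arbitrary: e F)
  case Nil
  then show ?case
    by (intro runsI exI[of _ 0]) (auto simp: represents_def)
next
  case (Cons p xs)
  obtain e1 F1 where e1: "exec_op p (e, F) = (e1, F1)" by fastforce
  have IH: "runs (Ops xs) (4 * length xs) Q e1 F1" using Cons e1 by simp
  show ?case
  proof (rule runsI)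
    fix P s assume pl: "placed P (pc s) (code (pc s) (Ops (p # xs)))" and r: "represents e F s"
    let ?s1 = "fold exec_instr (op_code p) s"
    have pl: "placed P (pc s) (op_code p)" "placed P (pc s + length (op_code p)) (concat (map op_code xs))"
      using placed_append[of P "pc s" "op_code p"] pl by simp_all
    have "op_ok p e" using Cons.prems by simp
    note op = op_correct[OF r this]
    have r1: "represents e1 F1 ?s1" using op(2) e1 by simp
    note st = reaches_straight[OF pl(1) straight_op op(1)]
    have "placed P (pc ?s1) (code (pc ?s1) (Ops xs))" using pl(2) st(2) by simp
    from runsE[OF IH this r1 refl] obtain t s' e' F' where *: "t \<le> 4 * length xs" "reaches W P t ?s1 s'"
      "pc s' = pc ?s1 + length (code (pc ?s1) (Ops xs))" "represents e' F' s'" "Q e' F'" by metis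
    show "\<exists>t\<le>4 * length (p # xs). \<exists>s' e' F'. reaches W P t s s' \<and>
        pc s' = pc s + length (code (pc s) (Ops (p # xs))) \<and> represents e' F' s' \<and> Q e' F'"
    proof (intro exI conjI)
      show "reaches W P (length (op_code p) + t) s s'" using reaches_trans[OF st(1) *(2)] .
      show "length (op_code p) + t \<le> 4 * length (p # xs)" using *(1) length_op[of p] by simp
      show "pc s' = pc s + length (code (pc s) (Ops (p # xs)))" using *(3) st(2) by simp
    qed fact+
  qed
qed

lemma runs_seq:
  assumes "runs c T (runs d U Q) e F"
  shows "runs (c ;; d) (T + U) Q e F"
proof (rule runsI)
  fix P s assume pl: "placed P (pc s) (code (pc s) (c ;; d))" and r: "represents e F s"
  let ?p = "code (pc s) c"
  have pl: "placed P (pc s) ?p" "placed P (pc s + length ?p) (code (pc s + length ?p) d)"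
    using placed_append[of P "pc s" ?p] pl by (simp_all add: Let_def)
  obtain t s1 e1 F1 where 1: "t \<le> T" "reaches W P t s s1" "pc s1 = pc s + length ?p"
      "represents e1 F1 s1" "runs d U Q e1 F1" using runsE[OF assms pl(1) r refl] by metis
  have "placed P (pc s1) (code (pc s1) d)" using pl(2) 1(3) by simp
  from runsE[OF 1(5) this 1(4) refl] obtain u s2 e2 F2 where 2: "u \<le> U" "reaches W P u s1 s2"
      "pc s2 = pc s1 + length (code (pc s1) d)" "represents e2 F2 s2" "Q e2 F2" by metis
  show "\<exists>t\<le>T + U. \<exists>s' e' F'. reaches W P t s s' \<and>
      pc s' = pc s + length (code (pc s) (c ;; d)) \<and> represents e' F' s' \<and> Q e' F'"
  proof (intro exI conjI)
    show "reaches W P (t + u) s s2" using reaches_trans 1(2) 2(2) .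
    show "pc s2 = pc s + length (code (pc s) (c ;; d))" using 1(3) 2(3) by (simp add: Let_def)
  qed (use 1 2 in auto)
qed

lemma represents_pc: "represents e F (s\<lparr>pc := l\<rparr>) \<longleftrightarrow> represents e F s"
  by (simp add: represents_def values_below_def)

lemma reaches_jump:
  assumes "placed P (pc s) (Jump l # p)" "represents e F s"
  shows "reaches W P 1 s (s\<lparr>pc := l\<rparr>)"
  using step_placed[OF assms(1)] assms(2) by (simp add: represents_def values_below_def)

lemma reaches_jump_zero:
  assumes "placed P (pc s) (JumpZero (reg x) l # p)" "represents e F s"
  shows "reaches W P 1 s (s\<lparr>pc := (if e x = 0 then l else Suc (pc s))\<rparr>)"
  using step_placed[OF assms(1)] assms(2) by (simp add: represents_def values_below_def)

lemma runs_if: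
  assumes c: "e x \<noteq> 0 \<Longrightarrow> runs c T Q e F" and d: "e x = 0 \<Longrightarrow> runs d T Q e F"
  shows "runs (IfNZ x c d) (T + 2) Q e F"
proof (rule runsI)
  fix P s assume pl: "placed P (pc s) (code (pc s) (IfNZ x c d))" and r: "represents e F s"
  let ?p = "code (Suc (pc s)) c"
  let ?mid = "pc s + length ?p + 2"
  let ?q = "code ?mid d"
  have pl0: "placed P (pc s) (JumpZero (reg x) ?mid # ?p @ Jump (?mid + length ?q) # ?q)"
    using pl by (simp add: Let_def)
  have pl1: "placed P (Suc (pc s)) (?p @ Jump (?mid + length ?q) # ?q)" using placed_Cons(1)[OF pl0] .
  have pl2: "placed P (Suc (pc s)) ?p" "placed P (Suc (pc s) + length ?p) (Jump (?mid + length ?q) # ?q)"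
    using placed_append[OF pl1] by auto
  have pl3: "placed P ?mid ?q" using placed_Cons(1)[OF pl2(2)] by simp
  have len: "length (code (pc s) (IfNZ x c d)) = length ?p + length ?q + 2" by (simp add: Let_def)
  note j0 = reaches_jump_zero[OF pl0 r]
  show "\<exists>t\<le>T + 2. \<exists>s' e' F'. reaches W P t s s' \<and>
      pc s' = pc s + length (code (pc s) (IfNZ x c d)) \<and> represents e' F' s' \<and> Q e' F'"
  proof (cases "e x = 0")
    case True
    let ?s = "s\<lparr>pc := ?mid\<rparr>"
    have "represents e F ?s" "pc ?s = ?mid" using r by (simp_all add: represents_pc)
    from runsE[OF d[OF True] pl3 this] obtain t s' e' F' where *: "t \<le> T" "reaches W P t ?s s'"
      "pc s' = ?mid + length ?q" "represents e' F' s'" "Q e' F'" by metis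
    have "reaches W P (1 + t) s s'" using reaches_trans[OF j0] *(2) True by simp
    moreover have "pc s' = pc s + length (code (pc s) (IfNZ x c d))" unfolding len *(3) by simp
    moreover have "1 + t \<le> T + 2" using *(1) by simp
    ultimately show ?thesis using *(4,5) by blast
  next
    case False
    let ?s = "s\<lparr>pc := Suc (pc s)\<rparr>"
    have "represents e F ?s" "pc ?s = Suc (pc s)" using r by (simp_all add: represents_pc)
    from runsE[OF c[OF False] pl2(1) this] obtain t s' e' F' where *: "t \<le> T" "reaches W P t ?s s'"
      "pc s' = Suc (pc s) + length ?p" "represents e' F' s'" "Q e' F'" by metis
    have j: "reaches W P 1 s' (s'\<lparr>pc := ?mid + length ?q\<rparr>)"
      using reaches_jump[of P s' _ ?q, OF _ *(4)] pl2(2) *(3) by simp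
    have "reaches W P (1 + t) s s'" using reaches_trans[OF j0] *(2) False by simp
    from reaches_trans[OF this j] have "reaches W P (1 + t + 1) s (s'\<lparr>pc := ?mid + length ?q\<rparr>)" .
    moreover have "pc (s'\<lparr>pc := ?mid + length ?q\<rparr>) = pc s + length (code (pc s) (IfNZ x c d))"
      unfolding len by simp
    moreover have "1 + t + 1 \<le> T + 2" using *(1) by simp
    moreover have "represents e' F' (s'\<lparr>pc := ?mid + length ?q\<rparr>)" using *(4) by (simp add: represents_pc)
    ultimately show ?thesis using *(5) by blast
  qed
qed

text \<open>
  The number \<open>k\<close> of iterations is known in advance for all loops at hand, so the invariant may refer to
  the index of the iteration, and so may the bound for the body.
\<close>

lemma runs_while:
  assumes step: "\<And>i e F. i < k \<Longrightarrow> I i e F \<Longrightarrow> e x \<noteq> 0 \<and> runs c (T i) (I (Suc i)) e F"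
    and exit: "\<And>e F. I k e F \<Longrightarrow> e x = 0 \<and> Q e F"
    and init: "I 0 e F"
  shows "runs (WhileNZ x c) ((\<Sum>i<k. T i + 2) + 1) Q e F"
proof -
  have "runs (WhileNZ x c) ((\<Sum>i=j..<k. T i + 2) + 1) Q e F" if "j \<le> k" "I j e F" for j e F
    using that
  proof (induction j arbitrary: e F rule: inc_induct)
    case base
    show ?case
    proof (rule runsI)
      fix P s assume pl: "placed P (pc s) (code (pc s) (WhileNZ x c))" and r: "represents e F s"
      have "e x = 0" "Q e F" using exit base by auto
      let ?l = "pc s + length (code (Suc (pc s)) c) + 2"
      have "placed P (pc s) (JumpZero (reg x) ?l # code (Suc (pc s)) c @ [Jump (pc s)])"
        using pl by (simp add: Let_def)
      from reaches_jump_zero[OF this r] have "reaches W P 1 s (s\<lparr>pc := ?l\<rparr>)"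
        using \<open>e x = 0\<close> by (simp only: if_True refl)
      moreover have "pc (s\<lparr>pc := ?l\<rparr>) = pc s + length (code (pc s) (WhileNZ x c))"
        by (simp add: Let_def)
      moreover have "represents e F (s\<lparr>pc := ?l\<rparr>)" using r by (simp only: represents_pc)
      moreover have "1 \<le> (\<Sum>i=k..<k. T i + 2) + 1" by simp
      ultimately show "\<exists>t\<le>(\<Sum>i=k..<k. T i + 2) + 1. \<exists>s' e' F'. reaches W P t s s' \<and>
          pc s' = pc s + length (code (pc s) (WhileNZ x c)) \<and> represents e' F' s' \<and> Q e' F'"
        using \<open>Q e F\<close> by blast
    qed
  next
    case (step j)
    show ?case
    proof (rule runsI)
      fix P s assume pl: "placed P (pc s) (code (pc s) (WhileNZ x c))" and r: "represents e F s"
      let ?p = "code (Suc (pc s)) c"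
      have pl0: "placed P (pc s) (JumpZero (reg x) (pc s + length ?p + 2) # ?p @ [Jump (pc s)])"
        using pl by (simp add: Let_def)
      note pl1 = placed_append[OF placed_Cons(1)[OF pl0]]
      have ex: "e x \<noteq> 0" "runs c (T j) (I (Suc j)) e F"
        using assms(1)[OF \<open>j < k\<close> \<open>I j e F\<close>] by auto
      let ?s = "s\<lparr>pc := Suc (pc s)\<rparr>"
      have "reaches W P 1 s ?s" using reaches_jump_zero[OF pl0 r] ex(1) by simp
      have "represents e F ?s" "pc ?s = Suc (pc s)" using r by (simp_all add: represents_pc)
      from runsE[OF ex(2) pl1(1) this] obtain t s1 e1 F1 where *: "t \<le> T j" "reaches W P t ?s s1"
        "pc s1 = Suc (pc s) + length ?p" "represents e1 F1 s1" "I (Suc j) e1 F1" by metis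
      let ?s1 = "s1\<lparr>pc := pc s\<rparr>"
      have j1: "reaches W P 1 s1 ?s1" using reaches_jump[of P s1 _ "[]", OF _ *(4)] pl1(2) *(3) by simp
      have "represents e1 F1 ?s1" "pc ?s1 = pc s" using *(4) by (simp_all add: represents_pc)
      from runsE[OF step.IH[OF *(5)] pl this] obtain u s2 e2 F2 where 2:
        "u \<le> (\<Sum>i=Suc j..<k. T i + 2) + 1" "reaches W P u ?s1 s2"
        "pc s2 = pc s + length (code (pc s) (WhileNZ x c))" "represents e2 F2 s2" "Q e2 F2"
        by metis
      have "reaches W P (1 + t + 1 + u) s s2"
        using reaches_trans[OF reaches_trans[OF reaches_trans[OF \<open>reaches W P 1 s ?s\<close> *(2)] j1] 2(2)] .
      moreover have "1 + t + 1 + u \<le> (\<Sum>i=j..<k. T i + 2) + 1"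
        using *(1) 2(1) \<open>j < k\<close> by (simp add: sum.atLeast_Suc_lessThan)
      ultimately show "\<exists>t\<le>(\<Sum>i=j..<k. T i + 2) + 1. \<exists>s' e' F'. reaches W P t s s' \<and>
          pc s' = pc s + length (code (pc s) (WhileNZ x c)) \<and> represents e' F' s' \<and> Q e' F'"
        using 2(3,4,5) by blast
    qed
  qed
  from this[of 0] show ?thesis using init by (simp add: atLeast0LessThan)
qed

text \<open>
  For programs without loops, the simplifier can evaluate the weakest precondition.
\<close>

primrec wp :: "com \<Rightarrow> (env \<Rightarrow> arrays \<Rightarrow> bool) \<Rightarrow> env \<Rightarrow> arrays \<Rightarrow> bool" where
  "wp (Ops xs) Q e F \<longleftrightarrow> wp_ops xs Q e F"
| "wp (c ;; d) Q e F \<longleftrightarrow> wp c (wp d Q) e F"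
| "wp (IfNZ x c d) Q e F \<longleftrightarrow> (if e x \<noteq> 0 then wp c Q e F else wp d Q e F)"
| "wp (WhileNZ x c) Q e F \<longleftrightarrow> False"

lemma runs_loop_free: "wp c Q e F \<Longrightarrow> runs c (cost c) Q e F"
proof (induction c arbitrary: Q e F)
  case (Ops xs)
  then show ?case using runs_Ops by simp
next
  case (Seq c d)
  have "runs c (cost c) (wp d Q) e F" using Seq.prems by (intro Seq.IH(1)) simp
  then have "runs c (cost c) (runs d (cost d) Q) e F"
    by (rule runs_mono) (simp_all add: Seq.IH(2))
  then show ?case by (simp add: runs_seq)
next
  case (IfNZ x c d)
  have "runs (IfNZ x c d) (cost c + cost d + 2) Q e F"
  proof (rule runs_if)
    assume "e x \<noteq> 0"
    then have "wp c Q e F" using IfNZ.prems by simp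
    from IfNZ.IH(1)[OF this] show "runs c (cost c + cost d) Q e F" by (rule runs_mono) simp_all
  next
    assume "e x = 0"
    then have "wp d Q e F" using IfNZ.prems by simp
    from IfNZ.IH(2)[OF this] show "runs d (cost c + cost d) Q e F" by (rule runs_mono) simp_all
  qed
  then show ?case by simp
next
  case (WhileNZ x c)
  then show ?case by simp
qed

lemma runs_wp: "wp c Q e F \<Longrightarrow> cost c \<le> T \<Longrightarrow> runs c T Q e F"
  by (rule runs_mono, erule runs_loop_free)

lemma runs_Ops_seq: "wp_ops xs (runs d T Q) e F \<Longrightarrow> runs (Ops xs ;; d) (4 * length xs + T) Q e F"
  by (rule runs_seq) (rule runs_Ops)

end

section \<open>The scan as a program\<close>

text \<open>
  The list is traversed backwards, so that one counter is both the index and the loop condition.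
\<close>

definition for_nbrs :: "var \<Rightarrow> com \<Rightarrow> com" where
  "for_nbrs y body =
     Ops [ODegree Cnt y] ;; WhileNZ Cnt (Ops [ODec Cnt, ONeighbor Nb y Cnt] ;; body)"

definition label_prog :: com where
  "label_prog =
     Ops [OGet Lab ALabel Ver] ;;
     IfNZ Lab (Ops [])
       (Ops [OConst Cnt 0, ONeighbor Nb Ver Cnt, OGet Lab ALabel Nb] ;;
        IfNZ Lab (Ops []) (Ops [OMov Lab Ver])) ;;
     Ops [OPut ALabel Ver Lab]"

definition spread_prog :: com where
  "spread_prog =
     for_nbrs Ver
       (Ops [OGet Cur ALabel Nb] ;;
        IfNZ Cur (Ops [OEq Flag Cur Lab, OCheck Flag]) (Ops [OPut ALabel Nb Lab]) ;;
        Ops [OPut AMark Nb Ver])"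

text \<open>
  For the first vertex of a class the tail is \<open>0\<close>, and the link is written into the dummy cell of
  \<open>ANext\<close>. The label itself is the head of the list.
\<close>

definition append_prog :: com where
  "append_prog =
     Ops [OGet Cur ATail Lab, OPut ANext Cur Ver, OPut ATail Lab Ver,
          OMov Cur Lab, OGet Flag AMark Cur, OEq Flag Flag Ver]"

text \<open>
  Loops while the current vertex is marked; it ends at the latest at the scanned vertex itself, which
  was appended to its class before and is not its own neighbour.
\<close>

definition walk_prog :: com where
  "walk_prog = WhileNZ Flag (Ops [OGet Cur ANext Cur, OGet Flag AMark Cur, OEq Flag Flag Ver])"

definition twin_prog :: com where
  "twin_prog = for_nbrs Cur (Ops [OGet Flag AMark Nb, OEq Flag Flag Ver, OCheck Flag])"

text \<open>
  At the start of a chain the chain vertex is \<open>0\<close>, which equals the initial stamp, so the first test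
  needs no special treatment.
\<close>

definition chain_prog :: com where
  "chain_prog =
     Ops [OGet Cur AChain Lab] ;;
     for_nbrs Ver
       (Ops [OGet Flag AStamp Nb, OEq Flag Flag Cur, OCheck Flag, OPut AStamp Nb Ver]) ;;
     Ops [OPut AChain Lab Ver]"

definition scan_prog :: com where
  "scan_prog =
     label_prog ;; spread_prog ;; append_prog ;; walk_prog ;;
     Ops [ODegree Flag Cur, ODegree Cnt Ver, OEq Flag Flag Cnt] ;;
     IfNZ Flag twin_prog chain_prog"

definition bucket_prog :: com where
  "bucket_prog =
     Ops [OSize Ver] ;;
     WhileNZ Ver
       (Ops [ODegree Dg Ver, OGet Cur AHead Dg, OPut ALink Ver Cur, OPut AHead Dg Ver, ODec Ver])"

definition main_prog :: com where
  "main_prog =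
     bucket_prog ;;
     Ops [OSize Dg] ;;
     WhileNZ Dg
       (Ops [OGet Ver AHead Dg] ;;
        WhileNZ Ver (scan_prog ;; Ops [OGet Ver ALink Ver]) ;;
        Ops [ODec Dg])"

section \<open>Correctness of the program\<close>

primrec linked :: "(nat \<Rightarrow> nat) \<Rightarrow> nat \<Rightarrow> nat list \<Rightarrow> bool" where
  "linked lk h [] \<longleftrightarrow> h = 0"
| "linked lk h (x # xs) \<longleftrightarrow> h = x \<and> linked lk (lk x) xs"

lemma linked_cong: "(\<And>x. x \<in> set xs \<Longrightarrow> lk' x = lk x) \<Longrightarrow> linked lk' h xs = linked lk h xs"
  by (induction xs arbitrary: h) auto

lemma linked_head: "linked lk h xs \<Longrightarrow> h = (if xs = [] then 0 else xs ! 0)"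
  by (cases xs) auto

lemma linked_nth:
  "linked lk h xs \<Longrightarrow> j < length xs \<Longrightarrow> lk (xs ! j) = (if Suc j < length xs then xs ! Suc j else 0)"
proof (induction xs arbitrary: h j)
  case (Cons x xs)
  then show ?case using linked_head[of lk "lk x" xs] by (cases j) auto
qed simp

locale ram_scan = ram_graph + neighbour_lists nb
begin

lemma nb_range: "u \<in> set (nb v) \<Longrightarrow> 1 \<le> u \<and> u \<le> n"
  using entries[of "v - 1"] by (auto simp: nb_def Suc_le_eq split: if_splits)

lemma nb_nonempty: "nb v \<noteq> [] \<Longrightarrow> 1 \<le> v \<and> v \<le> n"
  by (simp add: nb_def split: if_splits)

text \<open>
  In \<open>J k\<close> the neighbours with indices from \<open>k\<close> on have been treated.
\<close>

lemma runs_for_nbrs: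
  assumes y: "y \<noteq> Cnt" "y \<noteq> Nb" "e y = v" "1 \<le> v" "v \<le> n"
    and init: "J (deg v) (e(Cnt := deg v)) F"
    and body: "\<And>k e F. k < deg v \<Longrightarrow> J (Suc k) e F \<Longrightarrow> e y = v \<Longrightarrow> e Cnt = Suc k \<Longrightarrow>
      runs body T (\<lambda>e' F'. J k e' F' \<and> e' y = v \<and> e' Cnt = k) (e(Cnt := k, Nb := nb v ! k)) F"
    and exit: "\<And>e F. J 0 e F \<Longrightarrow> e y = v \<Longrightarrow> Q e F"
  shows "runs (for_nbrs y body) (deg v * (T + 10) + 5) Q e F"
proof -
  define I where "I i e F \<longleftrightarrow> i \<le> deg v \<and> J (deg v - i) e F \<and> e y = v \<and> e Cnt = deg v - i" for i e F
  have 1: "e Cnt \<noteq> 0 \<and> runs (Ops [ODec Cnt, ONeighbor Nb y Cnt] ;; body) (8 + T) (I (Suc i)) e F"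
    if "i < deg v" "I i e F" for i e F
  proof
    define k where "k = deg v - Suc i"
    have k: "k < deg v" "deg v - i = Suc k" using that(1) by (auto simp: k_def)
    have e: "J (Suc k) e F" "e y = v" "e Cnt = Suc k" using that k by (auto simp: I_def)
    then show "e Cnt \<noteq> 0" by simp
    have "runs body T (I (Suc i)) (e(Cnt := k, Nb := nb v ! k)) F"
      using body[OF k(1) e] by (rule runs_mono) (use that(1) in \<open>auto simp: I_def k_def\<close>)
    then show "runs (Ops [ODec Cnt, ONeighbor Nb y Cnt] ;; body) (8 + T) (I (Suc i)) e F"
      using y k e by (intro runs_Ops_seq[where xs = "[ODec Cnt, ONeighbor Nb y Cnt]", simplified]) simp
  qed
  have "runs (WhileNZ Cnt (Ops [ODec Cnt, ONeighbor Nb y Cnt] ;; body))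
      ((\<Sum>i<deg v. 8 + T + 2) + 1) Q (e(Cnt := deg v)) F"
    using 1 init exit y by (intro runs_while[where I = I]) (auto simp: I_def)
  then have "runs (for_nbrs y body) (4 + ((\<Sum>i<deg v. 8 + T + 2) + 1)) Q e F"
    unfolding for_nbrs_def using y by (intro runs_Ops_seq[where xs = "[ODegree Cnt y]", simplified]) simp
  then show ?thesis by (rule runs_mono) (simp_all add: algebra_simps)
qed

lemma set_drop_nth: "k < length xs \<Longrightarrow> set (drop k xs) = insert (xs ! k) (set (drop (Suc k) xs))"
  by (metis Cons_nth_drop_Suc list.simps(15))

lemma runs_label:
  assumes v: "e Ver = v" "nb v \<noteq> []" and l: "l = start_label nb (F ALabel) v"
  shows "runs label_prog 40
    (\<lambda>e' F'. e' Acc = e Acc \<and> e' Ver = v \<and> e' Dg = e Dg \<and> e' Lab = l \<and>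
       F' = F(ALabel := (F ALabel)(v := l))) e F"
proof (rule runs_wp)
  have "1 \<le> v" "v \<le> n" using nb_nonempty v by auto
  moreover have "nb v ! 0 = hd (nb v)" "hd (nb v) \<le> n"
    using v nb_range[of "hd (nb v)" v] by (auto simp: hd_conv_nth)
  ultimately show "wp label_prog (\<lambda>e' F'. e' Acc = e Acc \<and> e' Ver = v \<and> e' Dg = e Dg \<and> e' Lab = l \<and>
       F' = F(ALabel := (F ALabel)(v := l))) e F"
    using v by (auto simp: label_prog_def l start_label_def)
qed (simp add: label_prog_def)

lemma runs_spread:
  assumes v: "e Ver = v" "1 \<le> v" "v \<le> n" and l: "e Lab = l" "l \<noteq> 0" and g: "e Acc = of_bool g"
    and c: "c = F ALabel"
  shows "runs spread_prog (deg v * 40 + 5)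
    (\<lambda>e' F'. e' Acc = of_bool (g \<and> (\<forall>u\<in>N v. c u = 0 \<or> c u = l)) \<and>
       e' Ver = v \<and> e' Lab = l \<and> e' Dg = e Dg \<and>
       F' ALabel = (\<lambda>u. if u \<in> N v \<and> c u = 0 then l else c u) \<and>
       F' AMark = (\<lambda>u. if u \<in> N v then v else F AMark u) \<and>
       (\<forall>a. a \<noteq> ALabel \<longrightarrow> a \<noteq> AMark \<longrightarrow> F' a = F a)) e F"
proof -
  define J where "J k e' F' \<longleftrightarrow>
      e' Acc = of_bool (g \<and> (\<forall>u\<in>set (drop k (nb v)). c u = 0 \<or> c u = l)) \<and>
      e' Lab = l \<and> e' Dg = e Dg \<and>
      F' ALabel = (\<lambda>u. if u \<in> set (drop k (nb v)) \<and> c u = 0 then l else c u) \<and>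
      F' AMark = (\<lambda>u. if u \<in> set (drop k (nb v)) then v else F AMark u) \<and>
      (\<forall>a. a \<noteq> ALabel \<longrightarrow> a \<noteq> AMark \<longrightarrow> F' a = F a)" for k e' F'
  show ?thesis
    unfolding spread_prog_def
  proof (rule runs_mono[OF runs_for_nbrs[where v = v and J = J and T = 30]])
    fix k e' F' assume k: "k < deg v" and J: "J (Suc k) e' F'" and e: "e' Ver = v" "e' Cnt = Suc k"
    have "nb v ! k \<le> n" using nb_range k nth_mem by blast
    moreover have "nb v ! k \<notin> set (drop (Suc k) (nb v))"
      using nb_distinct[of v] k by (metis Cons_nth_drop_Suc distinct.simps(2) distinct_drop)
    ultimately show "runs (Ops [OGet Cur ALabel Nb] ;;
        IfNZ Cur (Ops [OEq Flag Cur Lab, OCheck Flag]) (Ops [OPut ALabel Nb Lab]) ;;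
        Ops [OPut AMark Nb Ver]) 30
      (\<lambda>e' F'. J k e' F' \<and> e' Ver = v \<and> e' Cnt = k) (e'(Cnt := k, Nb := nb v ! k)) F'"
      using J e l by (intro runs_wp) (auto simp: J_def set_drop_nth[OF k] fun_eq_iff)
  qed (use v l g c in \<open>auto simp: J_def\<close>)
qed

lemma runs_append:
  assumes v: "e Ver = v" "1 \<le> v" "v \<le> n" and l: "e Lab = l" "l \<le> n" and t: "F ATail l \<le> n"
  shows "runs append_prog 24
    (\<lambda>e' F'. e' Acc = e Acc \<and> e' Ver = v \<and> e' Lab = l \<and> e' Dg = e Dg \<and> e' Cur = l \<and>
       e' Flag = of_bool (F AMark l = v) \<and>
       F' = F(ANext := (F ANext)(F ATail l := v), ATail := (F ATail)(l := v))) e F"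
  using assms by (intro runs_wp) (auto simp: append_prog_def)

lemma runs_walk:
  assumes k: "k < length xs" "\<And>j. j < k \<Longrightarrow> F AMark (xs ! j) = v" "F AMark (xs ! k) \<noteq> v"
    and link: "\<And>j. Suc j < length xs \<Longrightarrow> F ANext (xs ! j) = xs ! Suc j"
    and le: "\<And>x. x \<in> set xs \<Longrightarrow> x \<le> n"
    and e: "e Ver = v" "e Cur = xs ! 0" "e Flag = of_bool (F AMark (xs ! 0) = v)"
  shows "runs walk_prog (k * 14 + 1)
    (\<lambda>e' F'. e' Acc = e Acc \<and> e' Ver = v \<and> e' Lab = e Lab \<and> e' Dg = e Dg \<and> e' Cur = xs ! k \<and>
       F' = F) e F"
proof -
  define I where "I i e' F' \<longleftrightarrow> i \<le> k \<and> e' Acc = e Acc \<and> e' Ver = v \<and> e' Lab = e Lab \<and>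
     e' Dg = e Dg \<and> e' Cur = xs ! i \<and> e' Flag = of_bool (F AMark (xs ! i) = v) \<and> F' = F" for i e' F'
  have "runs walk_prog ((\<Sum>i<k. 12 + 2) + 1)
    (\<lambda>e' F'. e' Acc = e Acc \<and> e' Ver = v \<and> e' Lab = e Lab \<and> e' Dg = e Dg \<and> e' Cur = xs ! k \<and>
       F' = F) e F"
    unfolding walk_prog_def
  proof (rule runs_while[where I = I])
    fix i e' F' assume i: "i < k" and I: "I i e' F'"
    have "xs ! i \<le> n" "xs ! Suc i \<le> n" using le i k(1) by auto
    moreover have "F ANext (xs ! i) = xs ! Suc i" using link i k(1) by simp
    ultimately show "e' Flag \<noteq> 0 \<and>
        runs (Ops [OGet Cur ANext Cur, OGet Flag AMark Cur, OEq Flag Flag Ver]) 12 (I (Suc i)) e' F'"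
      using I i k(2) by (intro conjI runs_wp) (auto simp: I_def)
  qed (use k e in \<open>auto simp: I_def\<close>)
  then show ?thesis by (rule runs_mono) simp_all
qed

lemma runs_twin:
  assumes x: "e Cur = x" "1 \<le> x" "x \<le> n" and v: "e Ver = v" and g: "e Acc = of_bool g"
  shows "runs twin_prog (deg x * 22 + 5)
    (\<lambda>e' F'. e' Acc = of_bool (g \<and> (\<forall>u\<in>N x. F AMark u = v)) \<and> e' Ver = v \<and> e' Dg = e Dg \<and> F' = F) e F"
proof -
  define J where "J k e' F' \<longleftrightarrow> e' Acc = of_bool (g \<and> (\<forall>u\<in>set (drop k (nb x)). F AMark u = v)) \<and>
     e' Ver = v \<and> e' Dg = e Dg \<and> F' = F" for k e' F'
  show ?thesis
    unfolding twin_prog_def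
  proof (rule runs_mono[OF runs_for_nbrs[where v = x and J = J and T = 12]])
    fix k e' F' assume k: "k < deg x" and J: "J (Suc k) e' F'" and e: "e' Cur = x" "e' Cnt = Suc k"
    have "nb x ! k \<le> n" using nb_range k nth_mem by blast
    then show "runs (Ops [OGet Flag AMark Nb, OEq Flag Flag Ver, OCheck Flag]) 12
        (\<lambda>e' F'. J k e' F' \<and> e' Cur = x \<and> e' Cnt = k) (e'(Cnt := k, Nb := nb x ! k)) F'"
      using J e by (intro runs_wp) (auto simp: J_def set_drop_nth[OF k])
  qed (use assms in \<open>auto simp: J_def\<close>)
qed

lemma runs_chain:
  assumes v: "e Ver = v" "1 \<le> v" "v \<le> n" and l: "e Lab = l" "l \<le> n" and g: "e Acc = of_bool g"
  shows "runs chain_prog (deg v * 26 + 13)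
    (\<lambda>e' F'. e' Acc = of_bool (g \<and> (\<forall>u\<in>N v. F AStamp u = F AChain l)) \<and> e' Ver = v \<and> e' Dg = e Dg \<and>
       F' AStamp = (\<lambda>u. if u \<in> N v then v else F AStamp u) \<and>
       F' AChain = (F AChain)(l := v) \<and>
       (\<forall>a. a \<noteq> AStamp \<longrightarrow> a \<noteq> AChain \<longrightarrow> F' a = F a)) e F"
proof -
  let ?body = "Ops [OGet Flag AStamp Nb, OEq Flag Flag Cur, OCheck Flag, OPut AStamp Nb Ver]"
  define J where "J k e' F' \<longleftrightarrow>
     e' Acc = of_bool (g \<and> (\<forall>u\<in>set (drop k (nb v)). F AStamp u = F AChain l)) \<and>
     e' Lab = l \<and> e' Dg = e Dg \<and> e' Cur = F AChain l \<and>
     F' AStamp = (\<lambda>u. if u \<in> set (drop k (nb v)) then v else F AStamp u) \<and>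
     (\<forall>a. a \<noteq> AStamp \<longrightarrow> F' a = F a)" for k e' F'
  have "runs (for_nbrs Ver ?body) (deg v * (16 + 10) + 5)
      (runs (Ops [OPut AChain Lab Ver]) 4
        (\<lambda>e' F'. e' Acc = of_bool (g \<and> (\<forall>u\<in>N v. F AStamp u = F AChain l)) \<and> e' Ver = v \<and> e' Dg = e Dg \<and>
       F' AStamp = (\<lambda>u. if u \<in> N v then v else F AStamp u) \<and>
       F' AChain = (F AChain)(l := v) \<and>
       (\<forall>a. a \<noteq> AStamp \<longrightarrow> a \<noteq> AChain \<longrightarrow> F' a = F a))) (e(Cur := F AChain l)) F"
  proof (rule runs_for_nbrs[where v = v and J = J])
    fix k e' F' assume k: "k < deg v" and J: "J (Suc k) e' F'" and e: "e' Ver = v" "e' Cnt = Suc k"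
    have "nb v ! k \<le> n" using nb_range k nth_mem by blast
    moreover have "nb v ! k \<notin> set (drop (Suc k) (nb v))"
      using nb_distinct[of v] k by (metis Cons_nth_drop_Suc distinct.simps(2) distinct_drop)
    ultimately show "runs ?body 16 (\<lambda>e' F'. J k e' F' \<and> e' Ver = v \<and> e' Cnt = k)
        (e'(Cnt := k, Nb := nb v ! k)) F'"
      using J e by (intro runs_wp) (auto simp: J_def set_drop_nth[OF k] fun_eq_iff)
  next
    fix e' F' assume "J 0 e' F'" "e' Ver = v"
    then show "runs (Ops [OPut AChain Lab Ver]) 4
        (\<lambda>e' F'. e' Acc = of_bool (g \<and> (\<forall>u\<in>N v. F AStamp u = F AChain l)) \<and> e' Ver = v \<and> e' Dg = e Dg \<and>
       F' AStamp = (\<lambda>u. if u \<in> N v then v else F AStamp u) \<and>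
       F' AChain = (F AChain)(l := v) \<and>
       (\<forall>a. a \<noteq> AStamp \<longrightarrow> a \<noteq> AChain \<longrightarrow> F' a = F a)) e' F'"
      using l by (intro runs_wp) (auto simp: J_def)
  qed (use v l g in \<open>auto simp: J_def\<close>)
  from runs_seq[OF this]
  have "runs chain_prog (4 + (deg v * (16 + 10) + 5 + 4))
    (\<lambda>e' F'. e' Acc = of_bool (g \<and> (\<forall>u\<in>N v. F AStamp u = F AChain l)) \<and> e' Ver = v \<and> e' Dg = e Dg \<and>
       F' AStamp = (\<lambda>u. if u \<in> N v then v else F AStamp u) \<and>
       F' AChain = (F AChain)(l := v) \<and>
       (\<forall>a. a \<noteq> AStamp \<longrightarrow> a \<noteq> AChain \<longrightarrow> F' a = F a)) e F"
    unfolding chain_prog_def using l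
    by (intro runs_Ops_seq[where xs = "[OGet Cur AChain Lab]", simplified]) simp
  then show ?thesis by (rule runs_mono) simp_all
qed

lemma runs_seq_step:
  assumes "runs c T R e F" "\<And>e' F'. R e' F' \<Longrightarrow> runs d U Q e' F'"
  shows "runs (c ;; d) (T + U) Q e F"
  using assms(1) by (intro runs_seq) (rule runs_mono, assumption, simp, rule assms(2))

definition label_class :: "scan_state \<Rightarrow> nat \<Rightarrow> nat list" where
  "label_class s l = filter (\<lambda>w. label s w = l) (visited s)"

text \<open>
  The linked list of a class is entered through its label, so the label must be its first element.
\<close>

definition wf_scan :: "scan_state \<Rightarrow> bool" where
  "wf_scan s \<longleftrightarrow> distinct (visited s) \<and> (\<forall>v\<in>set (visited s). 1 \<le> v \<and> v \<le> n \<and> label s v \<noteq> 0) \<and>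
     (\<forall>u. label s u \<noteq> 0 \<longrightarrow>
        label_class s (label s u) \<noteq> [] \<and> hd (label_class s (label s u)) = label s u)"

text \<open>
  Old marks are numbers of scanned vertices, so they cannot be mistaken for marks of a new vertex.
\<close>

definition simulates :: "scan_state \<Rightarrow> env \<Rightarrow> arrays \<Rightarrow> bool" where
  "simulates s e F \<longleftrightarrow>
     e Acc = of_bool (good s) \<and> F ALabel = label s \<and> F AStamp = stamp s \<and> F AChain = chain s \<and>
     (\<forall>u. F AMark u = 0 \<or> F AMark u \<in> set (visited s)) \<and>
     (\<forall>l. F ATail l = (if label_class s l = [] then 0 else last (label_class s l))) \<and>
     (\<forall>l j. Suc j < length (label_class s l) \<longrightarrow>
        F ANext (label_class s l ! j) = label_class s l ! Suc j)"

lemma label_class_scan: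
  assumes "wf_scan s"
  shows "label_class (scan nb v s) l =
    label_class s l @ (if l = start_label nb (label s) v then [v] else [])"
proof -
  have "label (scan nb v s) w = label s w" if "w \<in> set (visited s)" for w
    using that assms by (intro label_keep) (simp add: wf_scan_def)
  then have "filter (\<lambda>w. label (scan nb v s) w = l) (visited s) = label_class s l"
    unfolding label_class_def by (intro filter_cong) auto
  then show ?thesis by (simp add: label_class_def label_new)
qed

lemma wf_scan_label_visited:
  assumes "wf_scan s" "label s u \<noteq> 0"
  shows "label s u \<in> set (visited s)"
proof -
  have "hd (label_class s (label s u)) \<in> set (label_class s (label s u))"
    using assms by (intro hd_in_set) (simp add: wf_scan_def)
  then show ?thesis using assms by (auto simp: wf_scan_def label_class_def)
qed

lemma wf_scan_step:
  assumes wf: "wf_scan s" and v: "v \<notin> set (visited s)" "nb v \<noteq> []"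
  shows "wf_scan (scan nb v s)"
proof -
  let ?s = "scan nb v s"
  let ?l = "start_label nb (label s) v"
  have vn: "1 \<le> v" "v \<le> n" using nb_nonempty v by auto
  have l0: "?l \<noteq> 0" using start_label_nonzero vn by simp
  have old: "label_class s (label s u) \<noteq> []" "hd (label_class s (label s u)) = label s u"
    if "label s u \<noteq> 0" for u
    using wf that by (auto simp: wf_scan_def)
  have "label_class ?s (label ?s u) \<noteq> [] \<and> hd (label_class ?s (label ?s u)) = label ?s u"
    if u: "label ?s u \<noteq> 0" for u
  proof (cases "\<exists>w. label s w \<noteq> 0 \<and> label ?s u = label s w")
    case True
    then obtain w where "label s w \<noteq> 0" "label ?s u = label s w" by blast
    then show ?thesis using old[of w] by (simp add: label_class_scan[OF wf])
  next
    case False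
    then have "label s u = 0" using label_keep[of s u v] by auto
    then have lu: "label ?s u = ?l" using u by (simp add: label_scan spread_label_def split: if_splits)
    then have lv: "?l = v" using False l0 unfolding start_label_def by (metis (full_types))
    have "label_class s v = []"
      using wf_scan_label_visited[OF wf] v vn
      by (metis (mono_tags, lifting) filter_False label_class_def not_one_le_zero)
    then show ?thesis using lu lv by (simp add: label_class_scan[OF wf])
  qed
  moreover have "label ?s w \<noteq> 0" if "w \<in> set (visited s)" for w
    using wf that label_keep[of s w v] by (simp add: wf_scan_def)
  ultimately show ?thesis
    using wf v vn l0 label_new[of v s] by (auto simp: wf_scan_def)
qed

text \<open>
  The walk along the class passes only neighbours of \<open>v\<close>, and the list of the representative is read
  only if it is as long as that of \<open>v\<close>. Hence all loops have at most \<open>deg v\<close> iterations.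
\<close>

lemma runs_scan:
  assumes sim: "simulates s e F" and wf: "wf_scan s" and v: "e Ver = v" "v \<notin> set (visited s)" "nb v \<noteq> []"
  shows "runs scan_prog (100 * (deg v + 1))
    (\<lambda>e' F'. simulates (scan nb v s) e' F' \<and> e' Ver = v \<and> e' Dg = e Dg \<and>
       F' AHead = F AHead \<and> F' ALink = F ALink) e F" (is "runs _ _ ?Q _ _")
proof -
  let ?s = "scan nb v s"
  define c where "c = label s"
  define l where "l = start_label nb c v"
  define lab where "lab = spread_label nb c v"
  define ok where "ok \<longleftrightarrow> good s \<and> (\<forall>u\<in>N v. c u = 0 \<or> c u = l)"
  define mk where "mk = (\<lambda>u. if u \<in> N v then v else F AMark u)"
  define xs where "xs = label_class ?s l"
  \<comment> \<open>the walk stops at the first vertex of the class that is not a neighbour\<close>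
  define k where "k = length (takeWhile (\<lambda>w. w \<in> N v) xs)"
  have vn: "1 \<le> v" "v \<le> n" using nb_nonempty v by auto
  have wf': "wf_scan ?s" using wf_scan_step wf v by simp
  have l0: "l \<noteq> 0" using start_label_nonzero vn by (simp add: l_def)
  have labv: "label ?s v = l" by (simp add: label_new l_def c_def)
  have lab: "label ?s = lab" by (simp add: lab_def label_scan c_def)
  have "l \<in> set (visited ?s)" using wf_scan_label_visited[OF wf', of v] labv l0 by simp
  then have ln: "1 \<le> l" "l \<le> n" using wf' unfolding wf_scan_def by blast+
  have cls: "label_class ?s l' = label_class s l' @ (if l' = l then [v] else [])" for l'
    by (simp add: label_class_scan[OF wf] l_def c_def)
  have vis: "1 \<le> w" "w \<le> n" if "w \<in> set (visited s)" for w using wf that by (auto simp: wf_scan_def)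
  have class_vis: "w \<in> set (visited s)" if "w \<in> set (label_class s l')" for w l'
    using that by (auto simp: label_class_def)
  have xs: "xs = label_class s l @ [v]" by (simp add: xs_def cls)
  have xsn: "1 \<le> w \<and> w \<le> n" if "w \<in> set xs" for w using that vis class_vis vn by (auto simp: xs)
  have hd: "xs ! 0 = l"
    using wf' l0 labv unfolding wf_scan_def xs_def by (metis hd_conv_nth)
  have nv: "v \<notin> N v" using nb_irrefl by simp
  have k: "k < length xs" "\<And>j. j < k \<Longrightarrow> xs ! j \<in> N v" "xs ! k \<notin> N v"
  proof -
    show "k < length xs" unfolding k_def xs using nv
      by (simp add: takeWhile_append less_Suc_eq_le length_takeWhile_le)
    then show "xs ! k \<notin> N v" unfolding k_def by (rule nth_length_takeWhile)
    show "xs ! j \<in> N v" if "j < k" for j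
      using that set_takeWhileD nth_mem takeWhile_nth unfolding k_def by metis
  qed
  have kdeg: "k \<le> deg v"
  proof -
    have "distinct xs" using wf' by (simp add: xs_def label_class_def wf_scan_def)
    then have "k = card (set (takeWhile (\<lambda>w. w \<in> N v) xs))"
      unfolding k_def by (simp add: distinct_card)
    also have "\<dots> \<le> card (N v)" by (intro card_mono) (auto dest: set_takeWhileD)
    finally show ?thesis by (simp add: deg_card)
  qed
  define x where "x = xs ! k"
  \<comment> \<open>the vertex where the walk stops is the representative in the abstract scan\<close>
  have x_rep: "x = rep N lab (visited s @ [v]) v"
  proof -
    have split: "xs = take k xs @ x # drop (Suc k) xs"
      unfolding x_def by (rule id_take_nth_drop[OF k(1)])
    have "filter (\<lambda>w. w \<notin> N v) (take k xs) = []"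
      using k(2) by (auto simp: filter_empty_conv in_set_conv_nth)
    then have "filter (\<lambda>w. w \<notin> N v) xs = x # filter (\<lambda>w. w \<notin> N v) (drop (Suc k) xs)"
      using k(3) by (subst split) (simp add: x_def)
    then have "x = hd (filter (\<lambda>w. w \<notin> N v) xs)" by simp
    then show ?thesis
      using labv by (simp add: rep_def xs_def label_class_def lab filter_filter conj_commute)
  qed
  have xn: "1 \<le> x" "x \<le> n" using xsn k(1) by (auto simp: x_def)
  have S: "e Acc = of_bool (good s)" "F ALabel = c" "F AStamp = stamp s" "F AChain = chain s"
    "\<And>u. F AMark u = 0 \<or> F AMark u \<in> set (visited s)"
    "\<And>l. F ATail l = (if label_class s l = [] then 0 else last (label_class s l))"
    "\<And>l j. Suc j < length (label_class s l) \<Longrightarrow> F ANext (label_class s l ! j) = label_class s l ! Suc j"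
    using sim by (auto simp: simulates_def c_def)
  have mk: "mk u = v \<longleftrightarrow> u \<in> N v" for u
    using S(5)[of u] v vn by (auto simp: mk_def)
  have mk': "mk u = 0 \<or> mk u \<in> set (visited ?s)" for u
    using S(5)[of u] by (auto simp: mk_def)
  have scan_eq: "scan nb v s =
    (if deg x = deg v
     then s\<lparr>visited := visited s @ [v], label := lab, good := ok \<and> N x \<subseteq> N v\<rparr>
     else s\<lparr>visited := visited s @ [v], label := lab,
            stamp := (\<lambda>u. if u \<in> N v then v else stamp s u), chain := (chain s)(l := v),
            good := ok \<and> (\<forall>u\<in>N v. stamp s u = chain s l)\<rparr>)"
    by (simp add: scan_def Let_def x_rep ok_def lab_def l_def c_def)
  define tl where "tl = F ATail l"
  have tln: "tl \<le> n"
    using S(6)[of l] vis class_vis[of _ l] by (auto simp: tl_def)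
  let ?nx = "(F ANext)(tl := v)"
  have nx: "?nx (label_class ?s l' ! j) = label_class ?s l' ! Suc j"
    if j: "Suc j < length (label_class ?s l')" for l' j
  proof -
    let ?A = "label_class s l'"
    have A: "?A ! i \<in> set (visited s)" "label s (?A ! i) = l'" "?A ! i \<noteq> 0" if "i < length ?A" for i
      using nth_mem[OF that] vis(1)[of "?A ! i"] by (auto simp: label_class_def)
    show ?thesis
    proof (cases "l' = l")
      case False
      then have j': "Suc j < length ?A" using j by (simp add: cls)
      have "?A ! j \<noteq> tl"
      proof
        assume "?A ! j = tl"
        then have "tl \<noteq> 0" "label s tl = l'" using A[of j] j' by auto
        then show False
          using S(6)[of l] last_in_set[of "label_class s l"] False
          by (auto simp: tl_def label_class_def split: if_splits)
      qed
      then show ?thesis using S(7)[OF j'] False by (simp add: cls)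
    next
      case True
      then have j': "j < length ?A" using j by (simp add: cls)
      then have tl: "tl = last ?A" using S(6)[of l] True by (auto simp: tl_def)
      have d: "distinct ?A" using wf by (simp add: label_class_def wf_scan_def)
      show ?thesis
      proof (cases "Suc j < length ?A")
        case True
        have "?A \<noteq> []" using j' by auto
        then have "tl = ?A ! (length ?A - 1)" unfolding tl by (rule last_conv_nth)
        then have "?A ! j \<noteq> tl"
          using nth_eq_iff_index_eq[OF d j', of "length ?A - 1"] True by simp
        then show ?thesis using S(7)[OF True] True \<open>l' = l\<close> by (simp add: cls nth_append)
      next
        case False
        then have "j = length ?A - 1" using j' by simp
        moreover have "?A \<noteq> []" using j' by auto
        ultimately have "?A ! j = tl" using last_conv_nth[of ?A] by (simp add: tl)
        moreover have "label_class ?s l' ! Suc j = v"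
          using False j' \<open>l' = l\<close> by (simp add: cls nth_append less_Suc_eq_le)
        ultimately show ?thesis using j' by (simp add: cls nth_append)
      qed
    qed
  qed
  have tail: "((F ATail)(l := v)) l' =
      (if label_class ?s l' = [] then 0 else last (label_class ?s l'))" for l'
    using S(6)[of l'] by (simp add: cls)
  define B where "B F' \<longleftrightarrow> F' ALabel = lab \<and> F' AMark = mk \<and> F' AStamp = stamp s \<and>
     F' AChain = chain s \<and> F' ATail = (F ATail)(l := v) \<and> F' ANext = ?nx \<and>
     F' AHead = F AHead \<and> F' ALink = F ALink" for F'
  have r6: "runs (Ops [ODegree Flag Cur, ODegree Cnt Ver, OEq Flag Flag Cnt] ;;
      IfNZ Flag twin_prog chain_prog) (12 + (deg v * 26 + 13 + 2)) ?Q e' F'"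
    if e': "e' Acc = of_bool ok" "e' Ver = v" "e' Lab = l" "e' Dg = e Dg" "e' Cur = x" and B: "B F'"
    for e' F'
  proof -
    let ?e = "e'(Flag := of_bool (deg x = deg v), Cnt := deg v)"
    have "runs (IfNZ Flag twin_prog chain_prog) (deg v * 26 + 13 + 2) ?Q ?e F'"
    proof (rule runs_if)
      assume "?e Flag \<noteq> 0"
      then have d: "deg x = deg v" by (simp split: if_splits)
      have "runs twin_prog (deg x * 22 + 5)
          (\<lambda>e2 F2. e2 Acc = of_bool (ok \<and> (\<forall>u\<in>N x. F' AMark u = v)) \<and> e2 Ver = v \<and>
             e2 Dg = ?e Dg \<and> F2 = F') ?e F'"
        using e' xn by (intro runs_twin) auto
      then show "runs twin_prog (deg v * 26 + 13) ?Q ?e F'"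
      proof (rule runs_mono)
        fix e2 F2 assume *: "e2 Acc = of_bool (ok \<and> (\<forall>u\<in>N x. F' AMark u = v)) \<and> e2 Ver = v \<and>
             e2 Dg = ?e Dg \<and> F2 = F'"
        have "(\<forall>u\<in>N x. F' AMark u = v) \<longleftrightarrow> N x \<subseteq> N v" using B mk by (auto simp: B_def)
        then show "?Q e2 F2"
          using * B e' mk' tail nx d unfolding simulates_def B_def by (simp add: scan_eq)
      qed (simp add: d)
    next
      assume "?e Flag = 0"
      then have d: "deg x \<noteq> deg v" by (simp split: if_splits)
      have "runs chain_prog (deg v * 26 + 13)
        (\<lambda>e2 F2. e2 Acc = of_bool (ok \<and> (\<forall>u\<in>N v. F' AStamp u = F' AChain l)) \<and> e2 Ver = v \<and>
           e2 Dg = ?e Dg \<and> F2 AStamp = (\<lambda>u. if u \<in> N v then v else F' AStamp u) \<and>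
           F2 AChain = (F' AChain)(l := v) \<and>
           (\<forall>a. a \<noteq> AStamp \<longrightarrow> a \<noteq> AChain \<longrightarrow> F2 a = F' a)) ?e F'"
        using e' vn ln by (intro runs_chain) auto
      then show "runs chain_prog (deg v * 26 + 13) ?Q ?e F'"
      proof (rule runs_mono)
        fix e2 F2 assume *: "e2 Acc = of_bool (ok \<and> (\<forall>u\<in>N v. F' AStamp u = F' AChain l)) \<and> e2 Ver = v \<and>
           e2 Dg = ?e Dg \<and> F2 AStamp = (\<lambda>u. if u \<in> N v then v else F' AStamp u) \<and>
           F2 AChain = (F' AChain)(l := v) \<and>
           (\<forall>a. a \<noteq> AStamp \<longrightarrow> a \<noteq> AChain \<longrightarrow> F2 a = F' a)"
        then have F2: "F2 ALabel = lab" "F2 AMark = mk" "F2 ATail = (F ATail)(l := v)" "F2 ANext = ?nx"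
          "F2 AHead = F AHead" "F2 ALink = F ALink" using B by (simp_all add: B_def)
        have "F' AStamp = stamp s" "F' AChain = chain s" using B by (simp_all add: B_def)
        then have F2': "F2 AStamp = (\<lambda>u. if u \<in> N v then v else stamp s u)"
          "F2 AChain = (chain s)(l := v)" "e2 Acc = of_bool (ok \<and> (\<forall>u\<in>N v. stamp s u = chain s l))"
          using * by metis+
        have "good ?s \<longleftrightarrow> ok \<and> (\<forall>u\<in>N v. stamp s u = chain s l)" "chain ?s = (chain s)(l := v)"
          "stamp ?s = (\<lambda>u. if u \<in> N v then v else stamp s u)"
          using d by (simp_all add: scan_eq)
        then show "?Q e2 F2"
          unfolding simulates_def F2 F2' lab using * e' mk' tail nx by simp
      qed simp
    qed
    then show ?thesis
      using e' vn xn
      by (intro runs_Ops_seq[where xs = "[ODegree Flag Cur, ODegree Cnt Ver, OEq Flag Flag Cnt]", simplified])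
        (simp add: fun_upd_twist)
  qed
  have r5: "runs (walk_prog ;; Ops [ODegree Flag Cur, ODegree Cnt Ver, OEq Flag Flag Cnt] ;;
      IfNZ Flag twin_prog chain_prog) ((k * 14 + 1) + (12 + (deg v * 26 + 13 + 2))) ?Q e' F'"
    if e': "e' Acc = of_bool ok" "e' Ver = v" "e' Lab = l" "e' Dg = e Dg" "e' Cur = l"
      "e' Flag = of_bool (mk l = v)" and B: "B F'" for e' F'
  proof (rule runs_seq_step[OF runs_walk[where xs = xs and k = k and v = v]])
    show "F' AMark (xs ! k) \<noteq> v" using k(3) mk B by (simp add: B_def)
    show "F' AMark (xs ! j) = v" if "j < k" for j using k(2)[OF that] mk B by (simp add: B_def)
    show "F' ANext (xs ! j) = xs ! Suc j" if "Suc j < length xs" for j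
      using nx[of j l] that B by (simp add: B_def flip: xs_def)
  qed (use e' B hd k(1) xsn r6 in \<open>auto simp: B_def x_def\<close>)
  have r4: "runs (append_prog ;; walk_prog ;; Ops [ODegree Flag Cur, ODegree Cnt Ver, OEq Flag Flag Cnt] ;;
      IfNZ Flag twin_prog chain_prog) (24 + ((k * 14 + 1) + (12 + (deg v * 26 + 13 + 2)))) ?Q e' F'"
    if e': "e' Acc = of_bool ok" "e' Ver = v" "e' Lab = l" "e' Dg = e Dg"
      and F': "F' ALabel = lab" "F' AMark = mk" "\<And>a. a \<noteq> ALabel \<Longrightarrow> a \<noteq> AMark \<Longrightarrow> F' a = F a" for e' F'
  proof (rule runs_seq_step[OF runs_append[where v = v and l = l]])
    fix e2 F2 assume *: "e2 Acc = e' Acc \<and> e2 Ver = v \<and> e2 Lab = l \<and> e2 Dg = e' Dg \<and> e2 Cur = l \<and>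
      e2 Flag = of_bool (F' AMark l = v) \<and>
      F2 = F'(ANext := (F' ANext)(F' ATail l := v), ATail := (F' ATail)(l := v))"
    have "B F2" using * F' S by (simp add: B_def tl_def)
    then show "runs (walk_prog ;; Ops [ODegree Flag Cur, ODegree Cnt Ver, OEq Flag Flag Cnt] ;;
      IfNZ Flag twin_prog chain_prog) ((k * 14 + 1) + (12 + (deg v * 26 + 13 + 2))) ?Q e2 F2"
      using * e' F' by (intro r5) auto
  qed (use e' F' vn ln tln in \<open>auto simp: tl_def\<close>)
  let ?c = "c(v := l)"
  have spread: "(\<lambda>u. if u \<in> N v \<and> ?c u = 0 then l else ?c u) = lab"
    using nb_irrefl l0 by (auto simp: lab_def spread_label_def l_def fun_eq_iff)
  have ok: "ok \<longleftrightarrow> good s \<and> (\<forall>u\<in>N v. ?c u = 0 \<or> ?c u = l)"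
  proof -
    have "?c u = c u" if "u \<in> N v" for u using that nb_irrefl[of v] by auto
    then show ?thesis unfolding ok_def by metis
  qed
  have r3: "runs (spread_prog ;; append_prog ;; walk_prog ;;
      Ops [ODegree Flag Cur, ODegree Cnt Ver, OEq Flag Flag Cnt] ;; IfNZ Flag twin_prog chain_prog)
      ((deg v * 40 + 5) + (24 + ((k * 14 + 1) + (12 + (deg v * 26 + 13 + 2))))) ?Q e' F'"
    if e': "e' Acc = e Acc" "e' Ver = v" "e' Dg = e Dg" "e' Lab = l"
      and F': "F' = F(ALabel := (F ALabel)(v := l))" for e' F'
  proof (rule runs_seq_step[OF runs_spread[where v = v and l = l and g = "good s" and c = ?c]])
    fix e2 F2 assume *: "e2 Acc = of_bool (good s \<and> (\<forall>u\<in>N v. ?c u = 0 \<or> ?c u = l)) \<and>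
       e2 Ver = v \<and> e2 Lab = l \<and> e2 Dg = e' Dg \<and>
       F2 ALabel = (\<lambda>u. if u \<in> N v \<and> ?c u = 0 then l else ?c u) \<and>
       F2 AMark = (\<lambda>u. if u \<in> N v then v else F' AMark u) \<and>
       (\<forall>a. a \<noteq> ALabel \<longrightarrow> a \<noteq> AMark \<longrightarrow> F2 a = F' a)"
    show "runs (append_prog ;; walk_prog ;; Ops [ODegree Flag Cur, ODegree Cnt Ver, OEq Flag Flag Cnt] ;;
      IfNZ Flag twin_prog chain_prog) (24 + ((k * 14 + 1) + (12 + (deg v * 26 + 13 + 2)))) ?Q e2 F2"
    proof (rule r4)
      show "e2 Acc = of_bool ok" using * unfolding ok by blast
      show "F2 ALabel = lab" using * unfolding spread by blast
      have "F' AMark = F AMark" using F' by simp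
      then show "F2 AMark = mk" using * unfolding mk_def by metis
      show "F2 a = F a" if "a \<noteq> ALabel" "a \<noteq> AMark" for a using * F' that by simp
    qed (use * e' in auto)
  qed (use e' F' vn l0 S in auto)
  have "runs scan_prog
      (40 + ((deg v * 40 + 5) + (24 + ((k * 14 + 1) + (12 + (deg v * 26 + 13 + 2)))))) ?Q e F"
    unfolding scan_prog_def
    using v S by (intro runs_seq_step[OF runs_label[where v = v and l = l]] r3) (auto simp: l_def)
  then show ?thesis using kdeg by (rule_tac runs_mono) auto
qed

definition bucket :: "nat \<Rightarrow> nat list" where
  "bucket d = filter (\<lambda>v. deg v = d) [1..<Suc n]"

text \<open>
  The vertices of the \<open>k\<close> largest possible degrees. The degree \<open>0\<close> is omitted in \<open>order n\<close>.
\<close>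

definition order :: "nat \<Rightarrow> nat list" where
  "order k = concat (map bucket (rev [Suc (n - k)..<Suc n]))"

lemma deg_le: "deg v \<le> n"
proof -
  have "card (N v) \<le> card {1..n}" using nb_range by (intro card_mono) auto
  then show ?thesis by (simp add: deg_card)
qed

lemma order_0 [simp]: "order 0 = []"
  by (simp add: order_def)

lemma order_Suc: "k < n \<Longrightarrow> order (Suc k) = order k @ bucket (n - k)"
  by (simp add: order_def Suc_diff_Suc upt_conv_Cons[of "n - k"] del: upt_Suc)

lemma order_props:
  "k \<le> n \<Longrightarrow> set (order k) = {v \<in> {1..n}. n - k < deg v} \<and> distinct (order k) \<and>
     sorted_wrt (\<lambda>a b. deg b \<le> deg a) (order k)"
proof (induction k)
  case 0
  then show ?case using deg_le by (auto simp: not_less)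
next
  case (Suc k)
  have b: "set (bucket d) = {v \<in> {1..n}. deg v = d}" "distinct (bucket d)" for d
    by (auto simp: bucket_def simp del: upt_Suc)
  have "sorted_wrt (\<lambda>a b. deg b \<le> deg a) (bucket d)" for d
    by (rule sorted_wrt_mono_rel[of _ "\<lambda>a b. True"]) (auto simp: bucket_def simp del: upt_Suc)
  then show ?case
    using Suc b[of "n - k"] by (auto simp: order_Suc sorted_wrt_append)
qed

lemma set_order: "set (order n) = {v. nb v \<noteq> []}"
  using order_props[of n] nb_nonempty by auto

lemma wf_scan_fold:
  assumes "distinct vs" "\<forall>v\<in>set vs. nb v \<noteq> []"
  shows "wf_scan (fold (scan nb) vs scan_init)"
  using assms
proof (induction vs rule: rev_induct)
  case Nil
  then show ?case by (simp add: wf_scan_def scan_init_def)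
next
  case (snoc v vs)
  then show ?case by (auto intro!: wf_scan_step simp: visited_fold scan_init_def)
qed

lemma runs_bucket:
  assumes F: "\<And>d. F AHead d = 0"
  shows "runs bucket_prog (n * 22 + 5)
    (\<lambda>e' F'. e' Acc = e Acc \<and> (\<forall>d. linked (F' ALink) (F' AHead d) (bucket d)) \<and>
       (\<forall>a. a \<noteq> ALink \<longrightarrow> a \<noteq> AHead \<longrightarrow> F' a = F a)) e F" (is "runs _ _ ?Q _ _")
proof -
  define part where "part i d = filter (\<lambda>v. deg v = d) [Suc (n - i)..<Suc n]" for i d
  define I where "I i e' F' \<longleftrightarrow> i \<le> n \<and> e' Acc = e Acc \<and> e' Ver = n - i \<and>
      (\<forall>d. linked (F' ALink) (F' AHead d) (part i d)) \<and>
      (\<forall>a. a \<noteq> ALink \<longrightarrow> a \<noteq> AHead \<longrightarrow> F' a = F a)" for i e' F'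
  let ?body = "Ops [ODegree Dg Ver, OGet Cur AHead Dg, OPut ALink Ver Cur, OPut AHead Dg Ver, ODec Ver]"
  have "runs (WhileNZ Ver ?body) ((\<Sum>i<n. 20 + 2) + 1) ?Q (e(Ver := n)) F"
  proof (rule runs_while[where I = I])
    fix i e' F' assume i: "i < n" and I: "I i e' F'"
    define v where "v = n - i"
    have v: "e' Ver = v" "1 \<le> v" "v \<le> n" using I i by (auto simp: I_def v_def)
    have part: "part (Suc i) d = (if deg v = d then [v] else []) @ part i d" for d
      using i by (simp add: part_def v_def Suc_diff_Suc upt_conv_Cons[of "n - i"] del: upt_Suc)
    have "linked ((F' ALink)(v := h)) (F' AHead d) (part i d)" for d h
    proof -
      have "w \<noteq> v" if "w \<in> set (part i d)" for w using that by (auto simp: part_def v_def)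
      then show ?thesis
        using I linked_cong[of "part i d" "(F' ALink)(v := h)" "F' ALink"] by (auto simp: I_def)
    qed
    then show "e' Ver \<noteq> 0 \<and> runs ?body 20 (I (Suc i)) e' F'"
      using v I i deg_le[of v] by (intro conjI runs_wp) (auto simp: I_def part v_def)
  qed (use F in \<open>auto simp: I_def part_def bucket_def simp del: upt_Suc\<close>)
  then have "runs bucket_prog (4 + ((\<Sum>i<n. 20 + 2) + 1)) ?Q e F"
    unfolding bucket_prog_def by (intro runs_Ops_seq[where xs = "[OSize Ver]", simplified]) simp
  then show ?thesis by (rule runs_mono) simp_all
qed

text \<open>
  Turns the running time of the nested loops over the degrees and their buckets into a sum over the
  scanned vertices.
\<close>

lemma sum_bucket:
  "m \<le> n \<Longrightarrow> (\<Sum>k<m. length (bucket (n - k)) * f (n - k)) = sum_list (map (\<lambda>v. f (deg v)) (order m))"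
proof (induction m)
  case (Suc m)
  have "map (\<lambda>v. f (deg v)) (bucket d) = map (\<lambda>v. f d) (bucket d)" for d
    by (auto simp: bucket_def simp del: upt_Suc)
  then show ?case using Suc by (simp add: order_Suc map_replicate_const sum_list_replicate)
qed simp

lemma sum_deg: "(\<Sum>v=1..n. deg v) = length (concat adj)"
proof -
  have "(\<Sum>v=1..n. deg v) = (\<Sum>v<n. deg (Suc v))"
    by (simp add: sum.atLeast1_atMost_eq)
  also have "\<dots> = (\<Sum>v<n. length (adj ! v))" by (intro sum.cong) (auto simp: nb_def)
  also have "\<dots> = length (concat adj)"
    by (simp add: length_concat sum_list_sum_nth atLeast0LessThan)
  finally show ?thesis .
qed

lemma sum_order: "sum_list (map g (order n)) \<le> (\<Sum>v=1..n. g v)" for g :: "nat \<Rightarrow> nat"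
proof -
  have "sum_list (map g (order n)) = (\<Sum>v\<in>set (order n). g v)"
    using order_props[of n] by (simp add: sum_list_distinct_conv_sum_set)
  also have "\<dots> \<le> (\<Sum>v=1..n. g v)" using order_props[of n] by (intro sum_mono2) auto
  finally show ?thesis .
qed

lemma simulates_cong:
  assumes "simulates s e F" "e' Acc = e Acc"
  shows "simulates s e' F"
  using assms by (simp add: simulates_def)

lemma runs_inner:
  assumes sim: "simulates (fold (scan nb) vs scan_init) e F" and h: "e Ver = h" "linked (F ALink) h zs"
    and vs: "distinct (vs @ zs)" "\<forall>v\<in>set (vs @ zs). nb v \<noteq> []" and zs: "\<forall>v\<in>set zs. deg v = d"
  shows "runs (WhileNZ Ver (scan_prog ;; Ops [OGet Ver ALink Ver])) (length zs * (100 * (d + 1) + 6) + 1)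
    (\<lambda>e' F'. simulates (fold (scan nb) (vs @ zs) scan_init) e' F' \<and> e' Dg = e Dg \<and>
       F' AHead = F AHead \<and> F' ALink = F ALink) e F" (is "runs _ _ ?Q _ _")
proof -
  define I where "I j e' F' \<longleftrightarrow> j \<le> length zs \<and>
     simulates (fold (scan nb) (vs @ take j zs) scan_init) e' F' \<and>
     e' Ver = (if j < length zs then zs ! j else 0) \<and>
     e' Dg = e Dg \<and> F' AHead = F AHead \<and> F' ALink = F ALink" for j e' F'
  have "runs (WhileNZ Ver (scan_prog ;; Ops [OGet Ver ALink Ver]))
    ((\<Sum>j<length zs. (100 * (d + 1) + 4) + 2) + 1) ?Q e F"
  proof (rule runs_while[where I = I])
    fix j e' F' assume j: "j < length zs" and I: "I j e' F'"
    let ?v = "zs ! j"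
    let ?s = "fold (scan nb) (vs @ take j zs) scan_init"
    have v: "nb ?v \<noteq> []" "deg ?v = d" using vs zs j by auto
    have vn: "1 \<le> ?v" "?v \<le> n" using nb_nonempty v(1) by auto
    have split: "zs = take j zs @ ?v # drop (Suc j) zs" using j by (rule id_take_nth_drop)
    have dist: "distinct (vs @ take j zs @ ?v # drop (Suc j) zs)" using vs(1) split by simp
    have nz: "\<forall>v\<in>set (vs @ take j zs). nb v \<noteq> []" using vs(2) by (auto dest: in_set_takeD)
    have "wf_scan ?s" using dist nz by (intro wf_scan_fold) auto
    moreover have "?v \<notin> set (visited ?s)"
      unfolding visited_fold using dist by (auto simp: scan_init_def)
    moreover have "simulates ?s e' F'" "e' Ver = ?v" using I j by (simp_all add: I_def)
    ultimately have "runs scan_prog (100 * (deg ?v + 1))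
      (\<lambda>e2 F2. simulates (scan nb ?v ?s) e2 F2 \<and> e2 Ver = ?v \<and> e2 Dg = e' Dg \<and>
         F2 AHead = F' AHead \<and> F2 ALink = F' ALink) e' F'"
      using v by (intro runs_scan)
    then have "runs (scan_prog ;; Ops [OGet Ver ALink Ver]) (100 * (deg ?v + 1) + 4) (I (Suc j)) e' F'"
    proof (rule runs_seq_step)
      fix e2 F2 assume *: "simulates (scan nb ?v ?s) e2 F2 \<and> e2 Ver = ?v \<and> e2 Dg = e' Dg \<and>
         F2 AHead = F' AHead \<and> F2 ALink = F' ALink"
      have "F2 ALink ?v = (if Suc j < length zs then zs ! Suc j else 0)"
        using linked_nth[OF h(2) j] * I by (simp add: I_def)
      moreover have "fold (scan nb) (vs @ take (Suc j) zs) scan_init = scan nb ?v ?s"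
        using j by (simp add: take_Suc_conv_app_nth)
      ultimately show "runs (Ops [OGet Ver ALink Ver]) 4 (I (Suc j)) e2 F2"
        using * I j vn by (intro runs_wp) (auto simp: I_def elim: simulates_cong)
    qed
    then show "e' Ver \<noteq> 0 \<and> runs (scan_prog ;; Ops [OGet Ver ALink Ver]) (100 * (d + 1) + 4) (I (Suc j)) e' F'"
      using v vn I j by (simp add: I_def)
  qed (use sim h linked_head[OF h(2)] in \<open>auto simp: I_def\<close>)
  then show ?thesis by (rule runs_mono) simp_all
qed

lemma runs_main:
  assumes e: "e Acc = 1" and F: "\<And>a i. F a i = 0"
  shows "runs main_prog (150 * n + 100 * length (concat adj) + 30)
    (\<lambda>e' F'. e' Acc = of_bool (good (fold (scan nb) (order n) scan_init))) e F" (is "runs _ _ ?Q _ _")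
proof -
  define I where "I k e' F' \<longleftrightarrow> k \<le> n \<and> e' Dg = n - k \<and>
     simulates (fold (scan nb) (order k) scan_init) e' F' \<and>
     (\<forall>d. linked (F' ALink) (F' AHead d) (bucket d))" for k e' F'
  let ?inner = "WhileNZ Ver (scan_prog ;; Ops [OGet Ver ALink Ver])"
  let ?body = "Ops [OGet Ver AHead Dg] ;; ?inner ;; Ops [ODec Dg]"
  define T where "T k = 4 + ((length (bucket (n - k)) * (100 * (n - k + 1) + 6) + 1) + 4)" for k
  have body: "e' Dg \<noteq> 0 \<and> runs ?body (T k) (I (Suc k)) e' F'" if k: "k < n" and I: "I k e' F'" for k e' F'
  proof
    let ?z = "bucket (n - k)"
    have d: "e' Dg = n - k" using I by (simp add: I_def)
    then show "e' Dg \<noteq> 0" using k by simp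
    let ?e = "e'(Ver := F' AHead (n - k))"
    have os: "order (Suc k) = order k @ ?z" using k by (rule order_Suc)
    note props = order_props[of "Suc k", unfolded os]
    have nz: "\<forall>v\<in>set (order k @ ?z). nb v \<noteq> []" and dist: "distinct (order k @ ?z)"
      using props k by auto
    have "simulates (fold (scan nb) (order k) scan_init) e' F'" using I by (simp add: I_def)
    then have sim: "simulates (fold (scan nb) (order k) scan_init) ?e F'"
      by (rule simulates_cong) simp
    have ln: "linked (F' ALink) (F' AHead (n - k)) ?z" using I by (simp add: I_def)
    have z: "\<forall>v\<in>set ?z. deg v = n - k" by (simp add: bucket_def del: upt_Suc)
    have "runs ?inner (length ?z * (100 * (n - k + 1) + 6) + 1)
      (\<lambda>e2 F2. simulates (fold (scan nb) (order k @ ?z) scan_init) e2 F2 \<and> e2 Dg = ?e Dg \<and>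
         F2 AHead = F' AHead \<and> F2 ALink = F' ALink) ?e F'"
      by (rule runs_inner[OF sim fun_upd_same ln dist nz z])
    then have "runs (?inner ;; Ops [ODec Dg]) ((length ?z * (100 * (n - k + 1) + 6) + 1) + 4)
        (I (Suc k)) ?e F'"
    proof (rule runs_seq_step)
      fix e2 F2 assume "simulates (fold (scan nb) (order k @ ?z) scan_init) e2 F2 \<and> e2 Dg = ?e Dg \<and>
         F2 AHead = F' AHead \<and> F2 ALink = F' ALink"
      then show "runs (Ops [ODec Dg]) 4 (I (Suc k)) e2 F2"
        using I k by (intro runs_wp) (auto simp: I_def os elim: simulates_cong)
    qed
    then show "runs ?body (T k) (I (Suc k)) e' F'"
      unfolding T_def using d
      by (intro runs_Ops_seq[where xs = "[OGet Ver AHead Dg]", simplified]) simp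
  qed
  have loop: "runs (Ops [OSize Dg] ;; WhileNZ Dg ?body) (4 + ((\<Sum>k<n. T k + 2) + 1)) ?Q e' F'"
    if "e' Acc = 1" "\<forall>d. linked (F' ALink) (F' AHead d) (bucket d)"
      "\<forall>a. a \<noteq> ALink \<longrightarrow> a \<noteq> AHead \<longrightarrow> F' a = F a" for e' F'
  proof -
    have z: "F a = (\<lambda>_. 0)" for a using F by auto
    have "runs (WhileNZ Dg ?body) ((\<Sum>k<n. T k + 2) + 1) ?Q (e'(Dg := n)) F'"
    proof (rule runs_while[where I = I])
      show "I 0 (e'(Dg := n)) F'"
        using that z by (simp add: I_def simulates_def scan_init_def label_class_def)
      show "e2 Dg = 0 \<and> ?Q e2 F2" if "I n e2 F2" for e2 F2
        using that by (simp add: I_def simulates_def)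
    qed (rule body)
    then show ?thesis
      by (intro runs_Ops_seq[where xs = "[OSize Dg]", simplified]) simp
  qed
  have main: "runs main_prog ((n * 22 + 5) + (4 + ((\<Sum>k<n. T k + 2) + 1))) ?Q e F"
    unfolding main_prog_def
    by (rule runs_seq_step[OF runs_bucket[OF F]]) (rule loop, use e in auto)
  have "(\<Sum>k<n. T k + 2) = (\<Sum>k<n. length (bucket (n - k)) * (100 * (n - k + 1) + 6)) + 11 * n"
    by (simp add: T_def sum.distrib)
  also have "\<dots> = sum_list (map (\<lambda>v. 100 * (deg v + 1) + 6) (order n)) + 11 * n"
    using sum_bucket[of n "\<lambda>d. 100 * (d + 1) + 6"] by simp
  also have "\<dots> \<le> (\<Sum>v=1..n. 100 * (deg v + 1) + 6) + 11 * n"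
    using sum_order by (intro add_right_mono)
  also have "\<dots> = 100 * length (concat adj) + 117 * n"
    by (simp add: sum.distrib sum_deg[simplified] flip: sum_distrib_left)
  finally show ?thesis by (intro runs_mono[OF main]) auto
qed

end

section \<open>The program on an encoded graph\<close>

text \<open>
  Computes the base addresses of the arrays: the first one is found in cell \<open>n + 1\<close>, where the
  encoding stores the end of the last adjacency list, and the others follow at distance \<open>n + 1\<close>.
\<close>

definition prologue :: "instr list" where
  "prologue =
     [Const one_reg 1, Load tmp tmp, Add tmp tmp one_reg, Load 8 tmp,
      Add 9 8 tmp, Add 10 9 tmp, Add 11 10 tmp, Add 12 11 tmp, Add 13 12 tmp, Add 14 13 tmp,
      Add 15 14 tmp, Const 0 1]"

definition pwvd_program :: "instr list" where
  "pwvd_program = prologue @ code (length prologue) main_prog"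

text \<open>
  Each edge has two orientations, which are told apart by the truth value of \<open>v < u\<close>.
\<close>

lemma length_concat_adj_le:
  assumes "simple_graph {..<n} E" "adjacency_lists n E adj"
  shows "length (concat adj) \<le> 2 * card E"
proof -
  have fin: "finite E" using assms(1) by (auto simp: simple_graph_def intro: finite_subset[of E "Pow {..<n}"])
  have len: "length adj = n" using assms(2) by (simp add: adjacency_lists_def)
  have "length (adj ! v) = card (nbs E v)" if "v < n" for v
    using assms(2) that distinct_card[of "adj ! v"] by (simp add: adjacency_lists_def nbs_def)
  then have "length (concat adj) = (\<Sum>v<n. card (nbs E v))"
    by (simp add: length_concat sum_list_sum_nth atLeast0LessThan len)
  also have "\<dots> = card (SIGMA v:{..<n}. nbs E v)"
    using assms(1) nbs_simple(1)[OF assms(1)]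
    by (intro card_SigmaI[symmetric]) (auto intro: finite_subset[of _ "{..<n}"])
  also have "\<dots> \<le> card (E \<times> (UNIV :: bool set))"
  proof (rule card_inj_on_le[where f = "\<lambda>(v, u). ({v, u}, v < u)"])
    show "inj_on (\<lambda>(v, u). ({v, u}, v < u)) (SIGMA v:{..<n}. nbs E v)"
      by (auto simp: inj_on_def doubleton_eq_iff)
    show "(\<lambda>(v, u). ({v, u}, v < u)) ` (SIGMA v:{..<n}. nbs E v) \<subseteq> E \<times> UNIV"
      by (auto simp: nbs_def)
  qed (use fin in simp)
  also have "\<dots> = 2 * card E" by (simp add: card_cartesian_product)
  finally show ?thesis .
qed

locale input_graph =
  fixes E :: "nat set set" and adj :: "nat list list"
  assumes G: "simple_graph {..<length adj} E" and adj: "adjacency_lists (length adj) E adj"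
begin

definition W :: nat where "W = (length adj + card E + 2) ^ 5"

lemma adj_nbs: "v < length adj \<Longrightarrow> distinct (adj ! v) \<and> set (adj ! v) = nbs E v"
  using adj by (simp add: adjacency_lists_def nbs_def)

sublocale ram_graph adj W
proof
  show "u < length adj" if "v < length adj" "u \<in> set (adj ! v)" for u v
    using that adj_nbs nbs_simple(1)[OF G] by auto
  \<comment> \<open>the addresses are linear in \<open>?q\<close> with factor at most \<open>16\<close>, and \<open>?q\<close> is at least \<open>2\<close>\<close>
  let ?q = "length adj + card E + 2"
  have "2 ^ 4 * ?q \<le> ?q ^ 4 * ?q" by (intro mult_right_mono power_mono) auto
  also have "\<dots> = W" unfolding W_def power_Suc2[symmetric] by simp
  finally show "2 * length adj + length (concat adj) + 8 * (length adj + 1) + 2 < W"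
    using length_concat_adj_le[OF G adj] by simp
qed

lemma set_nb_Suc: "set (nb (Suc v)) = Suc ` nbs E v"
  using adj_nbs[of v] nbs_simple(2)[OF G, of _ v] by (auto simp: nb_def Suc_le_eq)

lemma set_nb_0: "set (nb 0) = {}"
  by (simp add: nb_def)

lemma Suc_in_nb [simp]: "Suc u \<in> set (nb (Suc v)) \<longleftrightarrow> u \<in> nbs E v"
  by (auto simp: set_nb_Suc)

lemma nb_pairE:
  assumes "u \<in> set (nb v)"
  obtains u' v' where "u = Suc u'" "v = Suc v'" "u' \<in> nbs E v'"
  using assms by (cases v) (auto simp: set_nb_0 set_nb_Suc)

sublocale ram_scan adj W
proof
  show "v \<in> set (nb u)" if "u \<in> set (nb v)" for u v
    using that by (elim nb_pairE) (metis Suc_in_nb nbs_sym)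
  show "v \<notin> set (nb v)" for v
    using nbs_simple(3)[OF G] by (auto elim!: nb_pairE)
  show "distinct (nb v)" for v
    using adj_nbs[of "v - 1"] by (auto simp: nb_def distinct_map)
  show "nb 0 = []" by (simp add: nb_def)
qed

lemma perfectly_iff_good:
  "perfectly_well_ve_dominated {..<n} E \<longleftrightarrow> good (fold (scan nb) (order n) scan_init)"
proof
  assume P: "perfectly_well_ve_dominated {..<n} E"
  interpret obstruction_free_lists nb
  proof
    show "P4_free N"
      using perfectly_imp_P4_free[OF G P] unfolding P4_free_def
      by (auto elim!: nb_pairE) blast
    show "butterfly_free N"
      using perfectly_imp_butterfly_free[OF G P] unfolding butterfly_free_def
      by (auto elim!: nb_pairE) blast
    show "co_P3_join_free N"
      using perfectly_imp_co_P3_join_free[OF G P] unfolding co_P3_join_free_def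
      by (auto elim!: nb_pairE) blast
  qed (use nb_sym nb_irrefl in auto)
  show "good (fold (scan nb) (order n) scan_init)"
    using order_props[of n] set_order by (intro sorted_imp_good) auto
next
  assume "good (fold (scan nb) (order n) scan_init)"
  then obtain c :: "nat \<Rightarrow> nat" and K where L: "layered UNIV N c K"
    using good_imp_layered set_order by metis
  then have L2: "c u = c v \<Longrightarrow> u \<in> K \<Longrightarrow> v \<in> K \<Longrightarrow> u \<in> N v \<or> N u = N v"
    and L3: "c u = c v \<Longrightarrow> u \<notin> K \<Longrightarrow> v \<notin> K \<Longrightarrow> N u \<subseteq> N v \<or> N v \<subseteq> N u" for u v
    unfolding layered_def by blast+
  have "layered {..<n} (nbs E) (c \<circ> Suc) {v. Suc v \<in> K}"
    unfolding layered_def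
  proof (intro conjI ballI impI)
    fix v u assume "u \<in> nbs E v"
    then have "Suc u \<in> N (Suc v)" by simp
    then show "(c \<circ> Suc) u = (c \<circ> Suc) v" using L unfolding layered_def by auto
  next
    fix u v assume "(c \<circ> Suc) u = (c \<circ> Suc) v" "u \<in> {v. Suc v \<in> K}" "v \<in> {v. Suc v \<in> K}"
    then have "Suc u \<in> N (Suc v) \<or> N (Suc u) = N (Suc v)" by (intro L2) simp_all
    then show "u \<in> nbs E v \<or> nbs E u = nbs E v" by (auto simp: set_nb_Suc inj_image_eq_iff)
  next
    fix u v assume "(c \<circ> Suc) u = (c \<circ> Suc) v" "u \<notin> {v. Suc v \<in> K}" "v \<notin> {v. Suc v \<in> K}"
    then have "N (Suc u) \<subseteq> N (Suc v) \<or> N (Suc v) \<subseteq> N (Suc u)" by (intro L3) simp_all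
    then show "nbs E u \<subseteq> nbs E v \<or> nbs E v \<subseteq> nbs E u" by (simp add: set_nb_Suc inj_image_subset_iff)
  qed
  then show "perfectly_well_ve_dominated {..<n} E"
    by (rule layered_imp_perfectly_well_ve_dominated[OF G])
qed

lemma encode_below: "x \<in> set (encode_graph adj) \<Longrightarrow> x < W"
proof -
  have "list_start adj v \<le> heap" for v
  proof -
    have "length (concat adj) = length (concat (take v adj)) + length (concat (drop v adj))"
      by (metis append_take_drop_id concat_append length_append)
    then show ?thesis by (simp add: list_start_def heap_def)
  qed
  moreover have "x < n" if "x \<in> set (concat adj)" for x
    using that entries by (auto simp: in_set_conv_nth[of _ adj])
  moreover assume "x \<in> set (encode_graph adj)"
  ultimately have "x \<le> heap" by (fastforce simp: encode_graph_def heap_def)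
  then show ?thesis using word_size by (simp add: heap_def)
qed

lemma prologue_correct:
  fixes s0 :: config
  defines "s0 \<equiv> initial_config (encode_graph adj)"
  shows "all_below W prologue s0"
    and "represents ((\<lambda>_. 0)(Acc := 1)) (\<lambda>_ _. 0) (fold exec_instr prologue s0)"
proof -
  have w: "heap + 8 * (n + 1) < W" using word_size by (simp add: heap_def)
  have regs: "regs s0 = (\<lambda>_. 0)"
    and mem: "mem s0 = (\<lambda>i. if i < heap then encode_graph adj ! i else 0)"
    using length_encode by (simp_all add: s0_def initial_config_def)
  have vb: "values_below W s0"
    using w encode_below length_encode by (auto simp: values_below_def regs mem)
  have m0: "mem s0 0 = n" by (simp add: mem heap_def encode_graph_def)
  have "list_start adj n = heap" by (simp add: list_start_def heap_def)
  then have m1: "mem s0 (Suc n) = heap"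
    using encode_nth_start[of n] by (simp add: mem heap_def)
  show below: "all_below W prologue s0"
    using w vb by (simp add: prologue_def regs m0 m1)
  let ?s = "fold exec_instr prologue s0"
  have "values_below W ?s" using w vb by (simp add: prologue_def regs m0 m1)
  moreover have "regs ?s (reg x) = ((\<lambda>_. 0)(Acc := 1)) x" for x
    by (cases x) (simp_all add: prologue_def regs)
  moreover have "regs ?s (base_reg a) = base a" for a
    by (cases a) (simp_all add: prologue_def regs base_def m0 m1)
  moreover have "regs ?s one_reg = 1" by (simp add: prologue_def)
  moreover have "mem ?s = mem s0" by (simp add: prologue_def)
  moreover have "\<not> base a + i < heap" for a i using heap_le_base[of a i] by simp
  ultimately show "represents ((\<lambda>_. 0)(Acc := 1)) (\<lambda>_ _. 0) ?s"
    unfolding represents_def by (simp add: mem)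
qed

theorem pwvd_program_correct:
  "\<exists>t\<le>300 * (n + card E + 1).
     halted pwvd_program (run pwvd_program t (initial_config (encode_graph adj))) \<and>
     (accepting (run pwvd_program t (initial_config (encode_graph adj))) \<longleftrightarrow>
        perfectly_well_ve_dominated {..<n} E) \<and>
     (\<forall>t'\<le>t. values_below W (run pwvd_program t' (initial_config (encode_graph adj))))"
proof -
  let ?s0 = "initial_config (encode_graph adj)"
  let ?s1 = "fold exec_instr prologue ?s0"
  have P: "placed pwvd_program (pc ?s0) prologue" "placed pwvd_program (length prologue) (code (length prologue) main_prog)"
    unfolding placed_def pwvd_program_def
    by (auto simp: initial_config_def intro: exI[of _ "[]"])
  have str: "list_all straight prologue" by (simp add: prologue_def)
  note st = reaches_straight[OF P(1) str prologue_correct(1)]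
  have pc1: "pc ?s1 = length prologue" using st(2) by (simp add: initial_config_def)
  have "runs main_prog (150 * n + 100 * length (concat adj) + 30)
    (\<lambda>e' F'. e' Acc = of_bool (good (fold (scan nb) (order n) scan_init)))
    ((\<lambda>_. 0)(Acc := 1)) (\<lambda>_ _. 0)"
    using runs_main[of "(\<lambda>_. 0)(Acc := 1)" "\<lambda>_ _. 0"] by simp
  from runsE[OF this P(2) prologue_correct(2) pc1] obtain t s' e' F' where
    t: "t \<le> 150 * n + 100 * length (concat adj) + 30" "reaches W pwvd_program t ?s1 s'"
    "pc s' = length prologue + length (code (length prologue) main_prog)" "represents e' F' s'"
    "e' Acc = of_bool (good (fold (scan nb) (order n) scan_init))" by metis
  have r: "reaches W pwvd_program (length prologue + t) ?s0 s'" using reaches_trans[OF st(1) t(2)] .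
  have "length prologue + t \<le> 300 * (n + card E + 1)"
    using t(1) length_concat_adj_le[OF G adj] by (simp add: prologue_def)
  moreover have "halted pwvd_program s'" using t(3) by (simp add: halted_def pwvd_program_def)
  moreover have "accepting s' \<longleftrightarrow> perfectly_well_ve_dominated {..<n} E"
  proof -
    have "regs s' (reg Acc) = e' Acc" using t(4) unfolding represents_def by blast
    then show ?thesis by (simp add: accepting_def t(5) perfectly_iff_good)
  qed
  ultimately show ?thesis using r unfolding reaches_run by blast
qed

end

theorem corollary12:
  "linear_time_recognizable perfectly_well_ve_dominated"
  unfolding linear_time_recognizable_def
proof (rule exI[of _ pwvd_program], rule exI[of _ 300], rule exI[of _ 5], intro allI impI)
  fix m E adj assume G: "simple_graph {..<m} E" "adjacency_lists m E adj"
  then have m: "m = length adj" by (simp add: adjacency_lists_def)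
  interpret input_graph E adj using G unfolding m by (rule input_graph.intro)
  show "\<exists>t\<le>300 * (m + card E + 1).
     halted pwvd_program (run pwvd_program t (initial_config (encode_graph adj))) \<and>
     (accepting (run pwvd_program t (initial_config (encode_graph adj))) \<longleftrightarrow>
        perfectly_well_ve_dominated {..<m} E) \<and>
     (\<forall>t'\<le>t. values_below ((m + card E + 2) ^ 5)
        (run pwvd_program t' (initial_config (encode_graph adj))))"
    using pwvd_program_correct unfolding W_def m .
qed

end
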